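(* For all integers $n \ge 32$ and $0 \le k \le n$ with $n-k$ even, there exists a CMDRR$(n,k)$.
   Context: A mixed doubles game is a match between two teams, each team consisting of one man and one woman; in a game $M_a F_b$ v $M_c F_d$, $M_a$ and $F_b$ are partners, $M_c$ and $F_d$ are partners, and each player of one team opposes each player of the other team. A complete mixed doubles round robin tournament CMDRR$(n,k)$ is a schedule (set) of mixed doubles games for $n$ men and $n$ women, of which $k$ men and $k$ women are paired into $k$ spouse pairs (a spouse pair is one man and one woman), such that: spouses never play in a game together as partners or opponents; every man and woman who are not spouses are partners exactly once and opponents exactly once; each player who has a spouse opposes every other player of the same sex exactly once; each player who does not have a spouse opposes some other same-sex player who does not have a spouse exactly twice and opposes all other same-sex players exactly once. *)

theory Defs
  imports Main
begin

text \<open>Players: men 0..<n and women 0..<n.  A game M_a F_b v M_c F_d is the tuple (a,b,c,d).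
  A schedule is a finite set of games.  Spouses are given by a partial matching Sp of
  k (man, woman) pairs.\<close>

type_synonym game = "nat \<times> nat \<times> nat \<times> nat"

definition wf_game :: "nat \<Rightarrow> game \<Rightarrow> bool" where
  "wf_game n g = (case g of (a,b,c,d) \<Rightarrow> a < n \<and> b < n \<and> c < n \<and> d < n \<and> a \<noteq> c \<and> b \<noteq> d)"

definition men_of :: "game \<Rightarrow> nat set" where
  "men_of g = (case g of (a,b,c,d) \<Rightarrow> {a, c})"

definition women_of :: "game \<Rightarrow> nat set" where
  "women_of g = (case g of (a,b,c,d) \<Rightarrow> {b, d})"

definition partner_count :: "game set \<Rightarrow> nat \<Rightarrow> nat \<Rightarrow> nat" where
  "partner_count G m w = card {g \<in> G. case g of (a,b,c,d) \<Rightarrow> (a = m \<and> b = w) \<or> (c = m \<and> d = w)}"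

definition mw_opp_count :: "game set \<Rightarrow> nat \<Rightarrow> nat \<Rightarrow> nat" where
  "mw_opp_count G m w = card {g \<in> G. case g of (a,b,c,d) \<Rightarrow> (a = m \<and> d = w) \<or> (c = m \<and> b = w)}"

definition men_opp_count :: "game set \<Rightarrow> nat \<Rightarrow> nat \<Rightarrow> nat" where
  "men_opp_count G m m' = card {g \<in> G. case g of (a,b,c,d) \<Rightarrow> (a = m \<and> c = m') \<or> (a = m' \<and> c = m)}"

definition women_opp_count :: "game set \<Rightarrow> nat \<Rightarrow> nat \<Rightarrow> nat" where
  "women_opp_count G w w' = card {g \<in> G. case g of (a,b,c,d) \<Rightarrow> (b = w \<and> d = w') \<or> (b = w' \<and> d = w)}"

definition spouse_matching :: "nat \<Rightarrow> nat \<Rightarrow> (nat \<times> nat) set \<Rightarrow> bool" where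
  "spouse_matching n k Sp \<longleftrightarrow> Sp \<subseteq> {..<n} \<times> {..<n} \<and> card Sp = k \<and>
     (\<forall>(m,w)\<in>Sp. \<forall>(m',w')\<in>Sp. (m = m' \<longleftrightarrow> w = w'))"

definition is_CMDRR :: "nat \<Rightarrow> nat \<Rightarrow> (nat \<times> nat) set \<Rightarrow> game set \<Rightarrow> bool" where
  "is_CMDRR n k Sp G \<longleftrightarrow>
     finite G \<and> (\<forall>g\<in>G. wf_game n g) \<and> spouse_matching n k Sp \<and>
     \<comment> \<open>spouses never play in a game together\<close>
     (\<forall>(m,w)\<in>Sp. \<forall>g\<in>G. \<not> (m \<in> men_of g \<and> w \<in> women_of g)) \<and>
     \<comment> \<open>non-spouses are partners exactly once and opponents exactly once\<close>
     (\<forall>m<n. \<forall>w<n. (m,w) \<notin> Sp \<longrightarrow> partner_count G m w = 1 \<and> mw_opp_count G m w = 1) \<and>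
     \<comment> \<open>players with a spouse oppose every other same-sex player exactly once\<close>
     (\<forall>m\<in>fst ` Sp. \<forall>m'<n. m' \<noteq> m \<longrightarrow> men_opp_count G m m' = 1) \<and>
     (\<forall>w\<in>snd ` Sp. \<forall>w'<n. w' \<noteq> w \<longrightarrow> women_opp_count G w w' = 1) \<and>
     \<comment> \<open>players without a spouse oppose one other unmarried same-sex player twice,
         all other same-sex players once\<close>
     (\<forall>m<n. m \<notin> fst ` Sp \<longrightarrow>
        (\<exists>m'<n. m' \<noteq> m \<and> m' \<notin> fst ` Sp \<and> men_opp_count G m m' = 2 \<and>
           (\<forall>m''<n. m'' \<noteq> m \<and> m'' \<noteq> m' \<longrightarrow> men_opp_count G m m'' = 1))) \<and>
     (\<forall>w<n. w \<notin> snd ` Sp \<longrightarrow>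
        (\<exists>w'<n. w' \<noteq> w \<and> w' \<notin> snd ` Sp \<and> women_opp_count G w w' = 2 \<and>
           (\<forall>w''<n. w'' \<noteq> w \<and> w'' \<noteq> w' \<longrightarrow> women_opp_count G w w'' = 1)))"

end

theory Submission
  imports Defs "HOL-Combinatorics.Permutations"
begin

text \<open>
  List every game in both orientations \<open>(a, b, c, d)\<close> and \<open>(c, d, a, b)\<close>. A CMDRR then prescribes how
  often each pair occurs in the columns \<open>ab\<close>, \<open>ad\<close>, \<open>ac\<close> and \<open>bd\<close>, so the defining conditions are
  additive in the set of games. A frame (a holey self-orthogonal Latin square) covers exactly the
  pairs of points in different holes; filling its holes \<open>h\<^sub>i\<close> with a CMDRR\<open>(h\<^sub>i, k\<^sub>i)\<close> gives a
  CMDRR\<open>(\<Sum>h\<^sub>i, \<Sum>k\<^sub>i)\<close>. Giving weight 2 to the points of four groups of a transversal design with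
  groups of size \<open>m\<close>, weight 0 or 2 to those of up to two further groups and a weight at most 3
  to those of the last group yields frames with hole sizes \<open>2m, 2m, 2m, 2m, 2r, 2s, u\<close> for
  \<open>r, s \<le> m\<close> and \<open>u \<le> 3m\<close>. Hence for \<open>n \<ge> 231\<close> the theorem follows by induction from
  \<open>n = 8m + u\<close> with \<open>m\<close> coprime to 6 and \<open>32 \<le> u \<le> 63\<close>. For smaller \<open>n\<close> the holes are filled with
  small tournaments, which come from explicit lists of games or from frames with a cyclic
  automorphism.
\<close>

section \<open>Games as multisets of quadruples\<close>

text \<open>A hole of size h only admits numbers of couples of the parity of h, and the holes
  together must produce every k of the right parity. The main construction therefore keeps all holes
  but one even. Once the large holes realise every value up to their sum, a further hole only has to
  offer its smallest and its largest value. The largest one is the obstacle: \<open>CM u u\<close>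
  amounts to a self-orthogonal Latin square of order u, and none exists for u = 2, 3, 6. These
  remainders cause the separately treated orders 34, 35, 38, 50, 51, 54, 66, 67, 70, 98, 99 and 102.
  The condition that m be coprime to 6 comes from the columns \<open>x + i * y\<close> with i = 0,
  ..., 4 and \<open>y\<close> modulo m, which then form six groups. Integers coprime to 6 leave gaps
  of at most 4, so u can be kept among 32 consecutive values; starting at 32 they end at 63, and 63
  \<le> 3m asks for m \<ge> 21. Where 2m is 10, 14, 22 or 26 the four large holes offer too few
  values on their own, and a hole of size 7 or 8 supplies the missing residues.\<close>

type_synonym 'a quad = "'a \<times> 'a \<times> 'a \<times> 'a"

definition swap :: "'a quad \<Rightarrow> 'a quad" where "swap q = (case q of (a,b,c,d) \<Rightarrow> (c,d,a,b))"
definition ab :: "'a quad \<Rightarrow> 'a \<times> 'a" where "ab q = (case q of (a,b,c,d) \<Rightarrow> (a,b))"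
definition ad :: "'a quad \<Rightarrow> 'a \<times> 'a" where "ad q = (case q of (a,b,c,d) \<Rightarrow> (a,d))"
definition ac :: "'a quad \<Rightarrow> 'a \<times> 'a" where "ac q = (case q of (a,b,c,d) \<Rightarrow> (a,c))"
definition bd :: "'a quad \<Rightarrow> 'a \<times> 'a" where "bd q = (case q of (a,b,c,d) \<Rightarrow> (b,d))"
definition map_quad :: "('a \<Rightarrow> 'b) \<Rightarrow> 'a quad \<Rightarrow> 'b quad" where
  "map_quad f q = (case q of (a,b,c,d) \<Rightarrow> (f a, f b, f c, f d))"

lemma quad_simps [simp]:
  "swap (a,b,c,d) = (c,d,a,b)" "ab (a,b,c,d) = (a,b)" "ad (a,b,c,d) = (a,d)"
  "ac (a,b,c,d) = (a,c)" "bd (a,b,c,d) = (b,d)" "map_quad f (a,b,c,d) = (f a, f b, f c, f d)"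
  by (simp_all add: swap_def ab_def ad_def ac_def bd_def map_quad_def)

lemma map_quad_swap: "swap (map_quad f q) = map_quad f (swap q)"
  by (cases q) simp

lemma map_quad_proj:
  "ab (map_quad f q) = map_prod f f (ab q)" "ad (map_quad f q) = map_prod f f (ad q)"
  "ac (map_quad f q) = map_prod f f (ac q)" "bd (map_quad f q) = map_prod f f (bd q)"
  by (cases q; simp)+

text \<open>\<open>P\<close> prescribes the numbers of partner and of opponent games of a man and a woman, \<open>U\<close> those
  of the games between two men and \<open>W\<close> those between two women.\<close>

definition sched :: "'a quad multiset \<Rightarrow> ('a \<times> 'a \<Rightarrow> nat) \<Rightarrow> ('a \<times> 'a \<Rightarrow> nat) \<Rightarrow> ('a \<times> 'a \<Rightarrow> nat) \<Rightarrow> bool" where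
  "sched M P U W \<longleftrightarrow> image_mset swap M = M \<and>
     count (image_mset ab M) = P \<and> count (image_mset ad M) = P \<and>
     count (image_mset ac M) = U \<and> count (image_mset bd M) = W"

lemma sched_empty: "sched {#} (\<lambda>_. 0) (\<lambda>_. 0) (\<lambda>_. 0)"
  by (simp add: sched_def fun_eq_iff)

lemma sched_add:
  assumes "sched M P U W" "sched M' P' U' W'"
  shows "sched (M + M') (\<lambda>z. P z + P' z) (\<lambda>z. U z + U' z) (\<lambda>z. W z + W' z)"
  using assms by (auto simp: sched_def fun_eq_iff)

lemma sched_sum:
  assumes "finite I" "\<And>i. i \<in> I \<Longrightarrow> sched (M i) (P i) (U i) (W i)"
  shows "sched (\<Sum>i\<in>I. M i) (\<lambda>z. \<Sum>i\<in>I. P i z) (\<lambda>z. \<Sum>i\<in>I. U i z) (\<lambda>z. \<Sum>i\<in>I. W i z)"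
  using assms
proof (induction I)
  case empty
  then show ?case by (simp add: sched_empty)
next
  case (insert i I)
  then show ?case using sched_add[of "M i" "P i" "U i" "W i"] by simp
qed

lemma sched_cong:
  "sched M P U W \<Longrightarrow> (\<And>z. P z = P' z) \<Longrightarrow> (\<And>z. U z = U' z) \<Longrightarrow> (\<And>z. W z = W' z) \<Longrightarrow> sched M P' U' W'"
  by (simp add: sched_def fun_eq_iff)

lemma count_image_mset_inj_on:
  assumes "inj_on f A" "x \<in> A" "set_mset N \<subseteq> A"
  shows "count (image_mset f N) (f x) = count N x"
proof -
  have "f -` {f x} \<inter> set_mset N \<subseteq> {x}" using assms by (auto dest: inj_onD)
  then have "f -` {f x} \<inter> set_mset N = (if x \<in># N then {x} else {})" by auto
  then show ?thesis by (auto simp: count_image_mset not_in_iff)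
qed

lemma count_map_prod:
  assumes f: "bij_betw f V V'" and s: "\<And>z. z \<notin> V \<times> V \<Longrightarrow> count N z = 0"
    and P': "\<And>z. z \<notin> V' \<times> V' \<Longrightarrow> P' z = 0"
    and eq: "\<And>x y. x \<in> V \<Longrightarrow> y \<in> V \<Longrightarrow> P' (f x, f y) = count N (x, y)"
  shows "count (image_mset (map_prod f f) N) = P'"
proof
  fix z
  have sub: "set_mset N \<subseteq> V \<times> V" using s by (metis not_in_iff subsetI)
  show "count (image_mset (map_prod f f) N) z = P' z"
  proof (cases "z \<in> V' \<times> V'")
    case True
    then obtain x y where xy: "x \<in> V" "y \<in> V" "z = map_prod f f (x, y)"
      using f by (auto simp: bij_betw_def)
    have "inj_on (map_prod f f) (V \<times> V)"
      using f by (auto simp: bij_betw_def inj_on_def)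
    then show ?thesis
      using count_image_mset_inj_on[of "map_prod f f" "V \<times> V" "(x,y)" N] xy eq sub by simp
  next
    case False
    then have "z \<notin># image_mset (map_prod f f) N"
      using sub f by (auto simp: bij_betw_def)
    then show ?thesis using P'[OF False] by (metis not_in_iff)
  qed
qed

text \<open>Relabelling the points moves all four columns at once; as the prescriptions vanish
  outside \<open>V\<close>, injectivity of \<open>f\<close> on \<open>V\<close> is enough.\<close>

lemma sched_transport:
  assumes M: "sched M P U W" and f: "bij_betw f V V'"
    and s: "\<And>z. z \<notin> V \<times> V \<Longrightarrow> P z = 0 \<and> U z = 0 \<and> W z = 0"
    and s': "\<And>z. z \<notin> V' \<times> V' \<Longrightarrow> P' z = 0 \<and> U' z = 0 \<and> W' z = 0"
    and eq: "\<And>x y. x \<in> V \<Longrightarrow> y \<in> V \<Longrightarrow>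
      P' (f x, f y) = P (x, y) \<and> U' (f x, f y) = U (x, y) \<and> W' (f x, f y) = W (x, y)"
  shows "sched (image_mset (map_quad f) M) P' U' W'"
proof -
  have sw: "image_mset swap (image_mset (map_quad f) M) = image_mset (map_quad f) (image_mset swap M)"
    by (simp add: multiset.map_comp o_def map_quad_swap)
  note pr = multiset.map_comp o_def map_quad_proj
  have c: "count (image_mset (\<lambda>q. map_prod f f (g q)) M) = X'"
    if "count (image_mset g M) = X" "\<And>z. z \<notin> V \<times> V \<Longrightarrow> X z = 0" "\<And>z. z \<notin> V' \<times> V' \<Longrightarrow> X' z = 0"
      "\<And>x y. x \<in> V \<Longrightarrow> y \<in> V \<Longrightarrow> X' (f x, f y) = X (x, y)" for g X X'
    using count_map_prod[OF f, of "image_mset g M" X'] that by (simp add: multiset.map_comp o_def)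
  have "count (image_mset ab (image_mset (map_quad f) M)) = P'"
    unfolding pr by (rule c[of ab P]) (use M s s' eq in \<open>auto simp: sched_def\<close>)
  moreover have "count (image_mset ad (image_mset (map_quad f) M)) = P'"
    unfolding pr by (rule c[of ad P]) (use M s s' eq in \<open>auto simp: sched_def\<close>)
  moreover have "count (image_mset ac (image_mset (map_quad f) M)) = U'"
    unfolding pr by (rule c[of ac U]) (use M s s' eq in \<open>auto simp: sched_def\<close>)
  moreover have "count (image_mset bd (image_mset (map_quad f) M)) = W'"
    unfolding pr by (rule c[of bd W]) (use M s s' eq in \<open>auto simp: sched_def\<close>)
  moreover have "image_mset swap M = M" using M by (simp add: sched_def)
  ultimately show ?thesis by (simp add: sched_def sw)
qed

definition frame_on :: "'a set \<Rightarrow> ('a \<Rightarrow> 'b) \<Rightarrow> 'a \<times> 'a \<Rightarrow> nat" where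
  "frame_on V h z = (if z \<in> V \<times> V \<and> h (fst z) \<noteq> h (snd z) then 1 else 0)"

definition is_frame :: "'a set \<Rightarrow> ('a \<Rightarrow> 'b) \<Rightarrow> 'a quad multiset \<Rightarrow> bool" where
  "is_frame V h M \<longleftrightarrow> sched M (frame_on V h) (frame_on V h) (frame_on V h)"

lemma is_frame_transport:
  assumes "is_frame V h M" "bij_betw f V V'"
    and "\<And>x y. x \<in> V \<Longrightarrow> y \<in> V \<Longrightarrow> h' (f x) = h' (f y) \<longleftrightarrow> h x = h y"
  shows "is_frame V' h' (image_mset (map_quad f) M)"
  unfolding is_frame_def
  by (rule sched_transport[OF assms(1)[unfolded is_frame_def] assms(2)])
    (use assms in \<open>auto simp: frame_on_def bij_betw_def\<close>)

definition mw_target :: "'a set \<Rightarrow> 'a set \<Rightarrow> 'a \<times> 'a \<Rightarrow> nat" where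
  "mw_target V K z = (if z \<in> V \<times> V \<and> \<not> (fst z = snd z \<and> fst z \<in> K) then 1 else 0)"

definition opp_target :: "'a set \<Rightarrow> 'a set \<Rightarrow> ('a \<Rightarrow> 'a) \<Rightarrow> 'a \<times> 'a \<Rightarrow> nat" where
  "opp_target V K \<mu> z = (if z \<in> V \<times> V \<and> fst z \<noteq> snd z then
     (if fst z \<notin> K \<and> snd z = \<mu> (fst z) then 2 else 1) else 0)"

text \<open>The map \<open>\<mu>\<close> sends an unmarried player to the player opposed twice; married couples consist of a
  man and a woman with the same label in \<open>K\<close>.\<close>

definition rival :: "'a set \<Rightarrow> ('a \<Rightarrow> 'a) \<Rightarrow> bool" where
  "rival S \<mu> \<longleftrightarrow> (\<forall>x\<in>S. \<mu> x \<in> S \<and> \<mu> x \<noteq> x)"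

text \<open>Men and women get separate maps because the unmarried men and the unmarried women may be
  paired off differently. Invariance under \<open>swap\<close> makes the counts symmetric, which
  forces each map to be an involution on the unmarried players.\<close>

definition is_cm :: "'a set \<Rightarrow> nat \<Rightarrow> 'a quad multiset \<Rightarrow> bool" where
  "is_cm V k M \<longleftrightarrow> (\<exists>K \<mu> \<nu>. K \<subseteq> V \<and> card K = k \<and> rival (V - K) \<mu> \<and> rival (V - K) \<nu> \<and>
     sched M (mw_target V K) (opp_target V K \<mu>) (opp_target V K \<nu>))"

definition CM :: "nat \<Rightarrow> nat \<Rightarrow> bool" where
  "CM n k \<longleftrightarrow> (\<exists>M. is_cm {..<n} k M)"

lemma is_cm_transport:
  assumes "is_cm V k M" "bij_betw f V V'"
  shows "\<exists>M'. is_cm V' k M'"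
proof -
  obtain K \<mu> \<nu> where K: "K \<subseteq> V" "card K = k" and r: "rival (V - K) \<mu>" "rival (V - K) \<nu>"
    and M: "sched M (mw_target V K) (opp_target V K \<mu>) (opp_target V K \<nu>)"
    using assms(1) unfolding is_cm_def by blast
  define g where "g = inv_into V f"
  have inj: "inj_on f V" and im: "f ` V = V'" using assms(2) by (auto simp: bij_betw_def)
  have g: "g (f x) = x" if "x \<in> V" for x using that inj by (simp add: g_def)
  have fK: "f x \<in> f ` K \<longleftrightarrow> x \<in> K" if "x \<in> V" for x using that K inj_on_image_mem_iff[OF inj] by blast
  have rv: "rival (V' - f ` K) (\<lambda>y. f (\<alpha> (g y)))" if "rival (V - K) \<alpha>" for \<alpha>
    unfolding rival_def
  proof
    fix y assume "y \<in> V' - f ` K"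
    then obtain x where x: "x \<in> V" "x \<notin> K" "y = f x" using im by blast
    then have "\<alpha> x \<in> V" "\<alpha> x \<notin> K" "\<alpha> x \<noteq> x" using that by (auto simp: rival_def)
    then show "f (\<alpha> (g y)) \<in> V' - f ` K \<and> f (\<alpha> (g y)) \<noteq> y"
      using x im by (auto simp: g fK inj_on_eq_iff[OF inj])
  qed
  have op: "opp_target V' (f ` K) (\<lambda>y. f (\<alpha> (g y))) (f x, f y) = opp_target V K \<alpha> (x, y)"
    if "rival (V - K) \<alpha>" "x \<in> V" "y \<in> V" for \<alpha> x y
  proof -
    have "x \<notin> K \<Longrightarrow> \<alpha> x \<in> V" using that by (auto simp: rival_def)
    then show ?thesis
      using that im by (auto simp: opp_target_def fK g inj_on_eq_iff[OF inj])
  qed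
  have "sched (image_mset (map_quad f) M) (mw_target V' (f ` K))
     (opp_target V' (f ` K) (\<lambda>y. f (\<mu> (g y)))) (opp_target V' (f ` K) (\<lambda>y. f (\<nu> (g y))))"
  proof (rule sched_transport[OF M assms(2)])
    fix x y assume xy: "x \<in> V" "y \<in> V"
    have "mw_target V' (f ` K) (f x, f y) = mw_target V K (x, y)"
      using xy im by (auto simp: mw_target_def fK inj_on_eq_iff[OF inj])
    then show "mw_target V' (f ` K) (f x, f y) = mw_target V K (x, y) \<and>
       opp_target V' (f ` K) (\<lambda>y. f (\<mu> (g y))) (f x, f y) = opp_target V K \<mu> (x, y) \<and>
       opp_target V' (f ` K) (\<lambda>y. f (\<nu> (g y))) (f x, f y) = opp_target V K \<nu> (x, y)"
      using op r xy by blast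
  qed (auto simp: mw_target_def opp_target_def)
  moreover have "card (f ` K) = k" using K inj by (metis card_image inj_on_subset)
  ultimately show ?thesis
    unfolding is_cm_def using K r rv im by blast
qed

lemma CM_iff: "finite V \<Longrightarrow> CM (card V) k \<longleftrightarrow> (\<exists>M. is_cm V k M)"
  unfolding CM_def
  by (metis is_cm_transport bij_betw_inv ex_bij_betw_nat_finite lessThan_atLeast0)

section \<open>Frames\<close>

text \<open>\<open>Fr hs\<close> says that there is a frame whose holes have the sizes \<open>hs\<close>; empty holes are allowed.\<close>

definition Fr :: "nat list \<Rightarrow> bool" where
  "Fr hs \<longleftrightarrow> (\<exists>M. is_frame (SIGMA i:{..<length hs}. {..<hs ! i}) fst M)"

text \<open>Only the hole sizes matter: one bijection per hole glues to a bijection of the points.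
  This direction moves the canonical frame onto a given set, \<open>FrI\<close> moves a given frame
  back.\<close>

lemma Fr_on:
  assumes hs: "Fr hs" and fin: "finite V" and h: "h ` V \<subseteq> {..<length hs}"
    and c: "\<And>i. i < length hs \<Longrightarrow> card {x \<in> V. h x = i} = hs ! i"
  shows "\<exists>M. is_frame V h M"
proof -
  obtain M where M: "is_frame (SIGMA i:{..<length hs}. {..<hs ! i}) fst M" (is "is_frame ?S _ _")
    using hs by (auto simp: Fr_def)
  have "\<exists>f. bij_betw f {..<hs ! i} {x \<in> V. h x = i}" if "i < length hs" for i
    using ex_bij_betw_nat_finite[of "{x \<in> V. h x = i}"] fin c[OF that] by (simp add: lessThan_atLeast0)
  then obtain f where f: "\<And>i. i < length hs \<Longrightarrow> bij_betw (f i) {..<hs ! i} {x \<in> V. h x = i}"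
    by metis
  define F where "F = (\<lambda>(i, x). f i x)"
  have hF: "F p \<in> V \<and> h (F p) = fst p" if "p \<in> ?S" for p
    using that f by (fastforce simp: F_def bij_betw_def)
  have "bij_betw F ?S V"
  proof (rule bij_betw_imageI)
    show "inj_on F ?S"
    proof (rule inj_onI)
      fix p q assume pq: "p \<in> ?S" "q \<in> ?S" "F p = F q"
      then have "fst p = fst q" using hF by metis
      moreover have "inj_on (f (fst p)) {..<hs ! fst p}" using f pq(1) by (auto simp: bij_betw_def)
      ultimately show "p = q" using pq by (auto simp: F_def dest: inj_onD)
    qed
    show "F ` ?S = V"
    proof (intro equalityI subsetI)
      fix y assume y: "y \<in> V"
      then have l: "h y < length hs" using h by auto
      then have "y \<in> f (h y) ` {..<hs ! h y}" using f[OF l] y by (simp add: bij_betw_def)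
      then obtain x where "x < hs ! h y" "f (h y) x = y" by auto
      then have "(h y, x) \<in> ?S" "F (h y, x) = y" using l by (auto simp: F_def)
      then show "y \<in> F ` ?S" by (metis imageI)
    qed (use hF in auto)
  qed
  then show ?thesis using is_frame_transport[OF M] hF by metis
qed

lemma FrI:
  assumes fr: "is_frame V h M" and h: "h ` V \<subseteq> {..<length hs}" and fin: "finite V"
    and c: "\<And>i. i < length hs \<Longrightarrow> card {x \<in> V. h x = i} = hs ! i"
  shows "Fr hs"
proof -
  have "\<exists>f. bij_betw f {x \<in> V. h x = i} {..<hs ! i}" if "i < length hs" for i
    using ex_bij_betw_finite_nat[of "{x \<in> V. h x = i}"] fin c[OF that] by (simp add: lessThan_atLeast0)
  then obtain f where f: "\<And>i. i < length hs \<Longrightarrow> bij_betw (f i) {x \<in> V. h x = i} {..<hs ! i}"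
    by metis
  let ?S = "SIGMA i:{..<length hs}. {..<hs ! i}"
  define F where "F = (\<lambda>x. (h x, f (h x) x))"
  have "bij_betw F V ?S"
  proof (rule bij_betw_imageI)
    show "inj_on F V"
    proof (rule inj_onI)
      fix x y assume xy: "x \<in> V" "y \<in> V" "F x = F y"
      then have "h x = h y" "h x < length hs" "f (h x) x = f (h x) y" using h by (auto simp: F_def)
      then show "x = y" using f[of "h x"] xy by (auto simp: bij_betw_def dest: inj_onD)
    qed
    show "F ` V = ?S"
    proof (intro equalityI subsetI)
      fix p assume "p \<in> F ` V"
      then obtain x where x: "x \<in> V" "p = F x" by auto
      then have "h x < length hs" using h by auto
      moreover have "f (h x) x < hs ! h x"
        using f[OF \<open>h x < length hs\<close>] x by (auto simp: bij_betw_def)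
      ultimately show "p \<in> ?S" using x by (auto simp: F_def)
    next
      fix p assume "p \<in> ?S"
      then obtain i z where p: "p = (i, z)" "i < length hs" "z < hs ! i" by auto
      then have "z \<in> f i ` {x \<in> V. h x = i}" using f[of i] by (auto simp: bij_betw_def)
      then obtain x where "x \<in> V" "h x = i" "z = f i x" by auto
      then show "p \<in> F ` V" using p by (auto simp: F_def)
    qed
  qed
  then show ?thesis unfolding Fr_def
    using is_frame_transport[OF fr, of F ?S fst] by (auto simp: F_def)
qed


lemma sum_single_index:
  fixes X :: "nat \<Rightarrow> nat"
  assumes "finite I" "\<And>k. k \<in> I \<Longrightarrow> k \<noteq> i \<Longrightarrow> X k = 0"
  shows "sum X I = (if i \<in> I then X i else 0)"
  using assms by (auto simp: sum.remove sum.neutral)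

text \<open>A pair of points in different holes is counted by the frame alone, a pair inside a hole
  by the tournament on that hole alone, so the counts add up to those of one tournament. Couples and
  rivals are collected hole by hole.\<close>

lemma Fr_fill:
  assumes hs: "Fr hs" and len: "length ks = length hs"
    and cm: "\<And>i. i < length hs \<Longrightarrow> CM (hs ! i) (ks ! i)"
  shows "CM (sum_list hs) (sum_list ks)"
proof -
  let ?l = "length hs" and ?S = "SIGMA i:{..<length hs}. {..<hs ! i}"
  let ?C = "\<lambda>i. {i} \<times> {..<hs ! i}"
  obtain M where M: "is_frame ?S fst M" using hs by (auto simp: Fr_def)
  have "\<exists>N. is_cm (?C i) (ks ! i) N" if "i < ?l" for i
    using cm[OF that] CM_iff[of "?C i" "ks ! i"] by simp
  then have "\<exists>N K \<mu> \<nu>. K \<subseteq> ?C i \<and> card K = ks ! i \<and> rival (?C i - K) \<mu> \<and> rival (?C i - K) \<nu> \<and>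
     sched N (mw_target (?C i) K) (opp_target (?C i) K \<mu>) (opp_target (?C i) K \<nu>)" if "i < ?l" for i
    using that unfolding is_cm_def by blast
  then obtain N K \<mu> \<nu> where N: "\<And>i. i < ?l \<Longrightarrow> K i \<subseteq> ?C i \<and> card (K i) = ks ! i \<and>
     rival (?C i - K i) (\<mu> i) \<and> rival (?C i - K i) (\<nu> i) \<and>
     sched (N i) (mw_target (?C i) (K i)) (opp_target (?C i) (K i) (\<mu> i)) (opp_target (?C i) (K i) (\<nu> i))"
    by metis
  define L where "L = (\<Union>i<?l. K i)"
  have KC: "p \<in> K i \<Longrightarrow> i < ?l \<Longrightarrow> fst p = i \<and> snd p < hs ! i" for p i using N by fastforce
  have inL: "(i, x) \<in> L \<longleftrightarrow> (i, x) \<in> K i" if "i < ?l" for i x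
    using that KC by (fastforce simp: L_def)
  have cardL: "card L = sum_list ks"
  proof -
    have "card L = (\<Sum>i<?l. card (K i))" unfolding L_def
    proof (rule card_UN_disjoint)
      show "\<forall>i\<in>{..<?l}. finite (K i)" using N by (meson finite.emptyI finite.insertI finite_SigmaI finite_lessThan finite_subset lessThan_iff)
      show "\<forall>i\<in>{..<?l}. \<forall>j\<in>{..<?l}. i \<noteq> j \<longrightarrow> K i \<inter> K j = {}"
        using KC by blast
    qed simp
    also have "\<dots> = sum_list ks" using N len by (simp add: sum_list_sum_nth lessThan_atLeast0)
    finally show ?thesis .
  qed
  have rv: "rival (?S - L) (\<lambda>p. \<alpha> (fst p) p)" if "\<And>i. i < ?l \<Longrightarrow> rival (?C i - K i) (\<alpha> i)" for \<alpha>
    unfolding rival_def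
  proof
    fix p assume p: "p \<in> ?S - L"
    then obtain i x where ix: "p = (i, x)" "i < ?l" "x < hs ! i" by auto
    then have "\<alpha> i p \<in> ?C i - K i \<and> \<alpha> i p \<noteq> p"
      using that[OF ix(2)] p inL[OF ix(2)] by (auto simp: rival_def)
    then show "\<alpha> (fst p) p \<in> ?S - L \<and> \<alpha> (fst p) p \<noteq> p"
      using ix inL[OF ix(2)] by auto
  qed
  have sum1: "(\<Sum>k<?l. X k ((i, x), (j, y))) = (if i < ?l then X i ((i, x), (j, y)) else 0)"
    if "\<And>k z. z \<notin> ?C k \<times> ?C k \<Longrightarrow> X k z = 0" for X :: "nat \<Rightarrow> _ \<Rightarrow> nat" and i x j y
  proof -
    have "X k ((i, x), (j, y)) = 0" if "k \<noteq> i" for k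
      by (rule \<open>\<And>k z. z \<notin> ?C k \<times> ?C k \<Longrightarrow> X k z = 0\<close>) (use that in simp)
    then show ?thesis using sum_single_index[of "{..<?l}" i "\<lambda>k. X k ((i, x), (j, y))"] by simp
  qed
  have T: "frame_on ?S fst z + (\<Sum>i<?l. mw_target (?C i) (K i) z) = mw_target ?S L z" for z
  proof -
    obtain i x j y where z: "z = ((i, x), (j, y))" by (metis surj_pair)
    have "(\<Sum>i<?l. mw_target (?C i) (K i) z) = (if i < ?l then mw_target (?C i) (K i) z else 0)"
      unfolding z by (rule sum1) (simp add: mw_target_def)
    then show ?thesis
      by (cases "i < ?l"; cases "i = j") (simp_all add: z mw_target_def frame_on_def inL)
  qed
  have O: "frame_on ?S fst z + (\<Sum>i<?l. opp_target (?C i) (K i) (\<alpha> i) z) = opp_target ?S L (\<lambda>p. \<alpha> (fst p) p) z"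
    if r: "\<And>i. i < ?l \<Longrightarrow> rival (?C i - K i) (\<alpha> i)" for \<alpha> z
  proof -
    obtain i x j y where z: "z = ((i, x), (j, y))" by (metis surj_pair)
    have "(\<Sum>i<?l. opp_target (?C i) (K i) (\<alpha> i) z) = (if i < ?l then opp_target (?C i) (K i) (\<alpha> i) z else 0)"
      unfolding z by (rule sum1) (simp add: opp_target_def)
    \<comment> \<open>A rival stays in its hole, so no pair across two holes is prescribed the value
      2.\<close>
    moreover have "(j, y) \<noteq> \<alpha> i (i, x)" if "i \<noteq> j" "i < ?l" "x < hs ! i" "(i, x) \<notin> K i"
    proof -
      have "\<alpha> i (i, x) \<in> ?C i" using r[OF that(2)] that by (simp add: rival_def)
      then show ?thesis using that(1) by auto
    qed
    ultimately show ?thesis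
      by (cases "i < ?l"; cases "i = j") (simp_all add: z opp_target_def frame_on_def inL, blast?)
  qed
  have "sched (M + (\<Sum>i<?l. N i)) (mw_target ?S L) (opp_target ?S L (\<lambda>p. \<mu> (fst p) p)) (opp_target ?S L (\<lambda>p. \<nu> (fst p) p))"
    by (rule sched_cong[OF sched_add[OF M[unfolded is_frame_def]
         sched_sum[of "{..<?l}" N "\<lambda>i. mw_target (?C i) (K i)"
           "\<lambda>i. opp_target (?C i) (K i) (\<mu> i)" "\<lambda>i. opp_target (?C i) (K i) (\<nu> i)"]]])
      (use N T O in auto)
  moreover have "L \<subseteq> ?S" using N by (fastforce simp: L_def)
  moreover have "rival (?S - L) (\<lambda>p. \<mu> (fst p) p)" "rival (?S - L) (\<lambda>p. \<nu> (fst p) p)"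
    using rv N by blast+
  ultimately have "is_cm ?S (sum_list ks) (M + (\<Sum>i<?l. N i))"
    unfolding is_cm_def using cardL by blast
  then have "CM (card ?S) (sum_list ks)" using CM_iff[of ?S] by auto
  moreover have "card ?S = sum_list hs" by (simp add: sum_list_sum_nth lessThan_atLeast0)
  ultimately show ?thesis by simp
qed

section \<open>Transversal designs\<close>

text \<open>An orthogonal array of strength 2: \<open>p\<close> indexes a block and
  \<open>A i p\<close> is the point in which it meets group \<open>i\<close>. Bijectivity says that
  two points of different groups lie in exactly one block.\<close>

definition TD :: "nat \<Rightarrow> nat \<Rightarrow> bool" where
  "TD k m \<longleftrightarrow> (\<exists>A :: nat \<Rightarrow> nat \<times> nat \<Rightarrow> nat.
     \<forall>i<k. \<forall>j<k. i \<noteq> j \<longrightarrow>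
       bij_betw (\<lambda>p. (A i p, A j p)) ({..<m} \<times> {..<m}) ({..<m} \<times> {..<m}))"

text \<open>The columns are \<open>x + i * y\<close> for the slopes i = 0, ..., k, and
  \<open>y\<close>. Columns of slopes i < j differ by \<open>(j - i) * y\<close>, and j - i is at
  most k, hence invertible modulo m.\<close>

lemma TD_linear:
  assumes cop: "\<And>d. 1 \<le> d \<Longrightarrow> d \<le> k \<Longrightarrow> coprime d m" and "m > 0"
  shows "TD (k + 2) m"
proof -
  define A where "A = (\<lambda>i (x, y). if i \<le> k then (x + i * y) mod m else y)"
  let ?P = "{..<m} \<times> {..<m}"
  have inj1: "(x, y) = (x', y')"
    if lt: "x < m" "x' < m" "y < m" "y' < m" and ij: "i < j" "j \<le> k + 1"
      and eq: "A i (x, y) = A i (x', y')" "A j (x, y) = A j (x', y')" for x y x' y' i j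
  proof -
    have i: "int m dvd (int x + int i * int y) - (int x' + int i * int y')"
      using eq(1) ij by (simp add: A_def flip: of_nat_mult of_nat_add) (metis mod_eq_dvd_iff zmod_int)
    have "y = y'"
    proof (cases "j \<le> k")
      case True
      then have "int m dvd (int x + int j * int y) - (int x' + int j * int y')"
        using eq(2) by (simp add: A_def flip: of_nat_mult of_nat_add) (metis mod_eq_dvd_iff zmod_int)
      from dvd_diff[OF this i] have "int m dvd int (j - i) * (int y - int y')"
        using ij by (simp add: of_nat_diff algebra_simps)
      moreover have "coprime (int m) (int (j - i))"
        using cop[of "j - i"] ij True by (simp add: coprime_commute del: of_nat_diff)
      ultimately have "int m dvd int y - int y'" by (simp add: coprime_dvd_mult_right_iff)
      then show ?thesis using lt by (metis mod_eq_dvd_iff mod_less of_nat_eq_iff zmod_int)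
    qed (use eq in \<open>simp add: A_def\<close>)
    moreover from this i have "int m dvd int x - int x'" by simp
    then have "x = x'" using lt by (metis mod_eq_dvd_iff mod_less of_nat_eq_iff zmod_int)
    ultimately show ?thesis by simp
  qed
  have "bij_betw (\<lambda>p. (A i p, A j p)) ?P ?P" if "i < k + 2" "j < k + 2" "i \<noteq> j" for i j
  proof -
    have "inj_on (\<lambda>p. (A i p, A j p)) ?P"
    proof (rule inj_onI)
      fix p q assume pq: "p \<in> ?P" "q \<in> ?P" "(A i p, A j p) = (A i q, A j q)"
      obtain x y x' y' where "p = (x, y)" "q = (x', y')" by fastforce
      then show "p = q"
        using pq that inj1[of x x' y y' i j] inj1[of x x' y y' j i] by (cases "i < j") auto
    qed
    moreover have "(\<lambda>p. (A i p, A j p)) ` ?P \<subseteq> ?P" using \<open>m > 0\<close> by (auto simp: A_def)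
    ultimately show ?thesis using endo_inj_surj[of ?P] by (simp add: bij_betw_def)
  qed
  then show ?thesis unfolding TD_def by blast
qed

text \<open>Wilson's fundamental construction: each point of the transversal design is inflated by its
  weight, and each block carries a frame with the weights of its points as hole sizes.\<close>

lemma Fr_wilson:
  assumes td: "TD (length ws) m"
    and fr: "\<And>c. (\<And>i. i < length ws \<Longrightarrow> c i < m) \<Longrightarrow> Fr (map (\<lambda>i. (ws ! i) (c i)) [0..<length ws])"
    and len: "2 \<le> length ws"
  shows "Fr (map (\<lambda>w. \<Sum>x<m. w x) ws)"
proof -
  let ?k = "length ws"
  let ?P = "{..<m} \<times> {..<m}"
  obtain A where A: "\<And>i j. i < ?k \<Longrightarrow> j < ?k \<Longrightarrow> i \<noteq> j \<Longrightarrow> bij_betw (\<lambda>p. (A i p, A j p)) ?P ?P"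
    using td unfolding TD_def by blast
  have Alt: "A i p < m" if "i < ?k" "p \<in> ?P" for i p
  proof -
    \<comment> \<open>The range of one column is only known through a pair of distinct columns; any
      second group serves.\<close>
    define j :: nat where "j = (if i = 0 then 1 else 0)"
    have "j < ?k" "i \<noteq> j" using len by (auto simp: j_def)
    from bij_betwE[OF A[OF that(1) this]] that(2) show ?thesis by fastforce
  qed
  define V where "V = (SIGMA i:{..<?k}. SIGMA x:{..<m}. {..<(ws ! i) x})"
  define B where "B p = {v \<in> V. fst (snd v) = A (fst v) p}" for p
  have finV: "finite V" by (auto simp: V_def)
  have "\<exists>M. is_frame (B p) fst M" if p: "p \<in> ?P" for p
  proof (rule Fr_on)
    show "Fr (map (\<lambda>i. (ws ! i) (A i p)) [0..<?k])" by (rule fr) (rule Alt[OF _ p])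
    show "fst ` B p \<subseteq> {..<length (map (\<lambda>i. (ws ! i) (A i p)) [0..<?k])}" by (auto simp: B_def V_def)
    fix i assume "i < length (map (\<lambda>i. (ws ! i) (A i p)) [0..<?k])"
    then have i: "i < ?k" by simp
    have "{x \<in> B p. fst x = i} = {i} \<times> {A i p} \<times> {..<(ws ! i) (A i p)}"
      using i Alt[OF i p] by (auto simp: B_def V_def)
    then show "card {x \<in> B p. fst x = i} = map (\<lambda>i. (ws ! i) (A i p)) [0..<?k] ! i"
      using i by simp
  qed (auto simp: B_def finV)
  then obtain M where M: "\<And>p. p \<in> ?P \<Longrightarrow> is_frame (B p) fst (M p)" by metis
  have T: "(\<Sum>p\<in>?P. frame_on (B p) fst z) = frame_on V fst z" for z
  proof -
    obtain u v where z: "z = (u, v)" by (cases z)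
    show ?thesis
    proof (cases "u \<in> V \<and> v \<in> V \<and> fst u \<noteq> fst v")
      case False
      then have "frame_on (B p) fst z = 0" for p by (auto simp: frame_on_def z B_def)
      then show ?thesis using False by (auto simp: frame_on_def z)
    next
      case True
      \<comment> \<open>The two points lie in different groups, so exactly one block
        \<open>p0\<close> contains both underlying points, and it alone contributes to the
        sum.\<close>
      let ?f = "\<lambda>p. (A (fst u) p, A (fst v) p)" and ?w = "(fst (snd u), fst (snd v))"
      have bij: "bij_betw ?f ?P ?P" using True by (intro A) (auto simp: V_def)
      moreover have "?w \<in> ?P" using True by (auto simp: V_def)
      ultimately have "?w \<in> ?f ` ?P" by (simp only: bij_betw_imp_surj_on)
      then obtain p0 where p0: "?w = ?f p0" "p0 \<in> ?P" by (rule imageE)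
      have p0': "p = p0" if "p \<in> ?P" "?f p = ?w" for p
        using inj_onD[OF bij_betw_imp_inj_on[OF bij] _ that(1) p0(2)] p0(1) that(2) by simp
      have "frame_on (B p) fst z = (if p = p0 then 1 else 0)" if "p \<in> ?P" for p
        using True p0(1) p0'[OF that] by (auto simp: frame_on_def z B_def)
      then have "(\<Sum>p\<in>?P. frame_on (B p) fst z) = 1" using p0(2) by (simp add: sum.delta)
      then show ?thesis using True by (simp add: frame_on_def z)
    qed
  qed
  have "is_frame V fst (\<Sum>p\<in>?P. M p)" unfolding is_frame_def
    by (rule sched_cong[OF sched_sum[of ?P M "\<lambda>p. frame_on (B p) fst" "\<lambda>p. frame_on (B p) fst" "\<lambda>p. frame_on (B p) fst"]])
      (use M T in \<open>auto simp: is_frame_def\<close>)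
  then show ?thesis
  proof (rule FrI)
    show "fst ` V \<subseteq> {..<length (map (\<lambda>w. \<Sum>x<m. w x) ws)}" by (auto simp: V_def)
    fix i assume "i < length (map (\<lambda>w. \<Sum>x<m. w x) ws)"
    then have i: "i < ?k" by simp
    have "{x \<in> V. fst x = i} = {i} \<times> (SIGMA x:{..<m}. {..<(ws ! i) x})"
      using i by (auto simp: V_def)
    then show "card {x \<in> V. fst x = i} = map (\<lambda>w. \<Sum>x<m. w x) ws ! i"
      using i by (simp add: card_cartesian_product)
  qed (rule finV)
qed

lemma Fr_append_0: "Fr (hs @ [0]) \<longleftrightarrow> Fr hs"
proof -
  have "(SIGMA i:{..<length (hs @ [0])}. {..<(hs @ [0]) ! i}) = (SIGMA i:{..<length hs}. {..<hs ! i})"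
    by (auto simp: nth_append less_Suc_eq split: if_splits)
  then show ?thesis by (simp only: Fr_def)
qed

lemma Fr_perm:
  assumes "Fr hs" "mset hs = mset hs'"
  shows "Fr hs'"
proof -
  obtain p where p: "p permutes {..<length hs'}" "permute_list p hs' = hs"
    using mset_eq_permutation[of hs hs'] assms(2) by auto
  have len: "length hs = length hs'" using assms(2) mset_eq_length by blast
  have nth: "hs ! i = hs' ! p i" if "i < length hs'" for i
    using p that by (metis permute_list_nth)
  have pl: "p i < length hs' \<longleftrightarrow> i < length hs'" for i
    using p(1) by (metis lessThan_iff permutes_in_image)
  let ?S = "SIGMA i:{..<length hs}. {..<hs ! i}" and ?S' = "SIGMA i:{..<length hs'}. {..<hs' ! i}"
  obtain M where M: "is_frame ?S fst M" using assms(1) by (auto simp: Fr_def)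
  let ?f = "map_prod p id"
  have "bij_betw ?f ?S ?S'"
  proof (rule bij_betwI[where g = "map_prod (inv p) id"])
    show "map_prod p id \<in> ?S \<rightarrow> ?S'"
    proof
      fix v assume "v \<in> ?S"
      then obtain i x where "v = (i, x)" "i < length hs" "x < hs ! i" by blast
      then show "map_prod p id v \<in> ?S'" using nth[of i] pl[of i] len by simp
    qed
    show "map_prod (inv p) id \<in> ?S' \<rightarrow> ?S"
    proof
      fix v assume v: "v \<in> ?S'"
      moreover have "inv p (fst v) < length hs'" using v permutes_in_image[OF permutes_inv[OF p(1)], of "fst v"] by auto
      ultimately show "map_prod (inv p) id v \<in> ?S"
        using nth[of "inv p (fst v)"] len by (cases v) (simp add: permutes_inverses[OF p(1)])
    qed
  qed (auto simp: permutes_inverses[OF p(1)])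
  moreover have "fst (?f x) = fst (?f y) \<longleftrightarrow> fst x = fst y" for x y
    using permutes_inj[OF p(1)] by (simp add: inj_eq)
  ultimately have "is_frame ?S' fst (image_mset (map_quad ?f) M)"
    by (intro is_frame_transport[OF M]) simp_all
  then show ?thesis unfolding Fr_def by blast
qed

section \<open>From quadruples to tournaments\<close>

text \<open>The passage from both orientations of a game to one: \<open>\<phi>\<close> picks the
  orientation with the smaller first man. It is injective on a fibre of \<open>f\<close> because a
  game and its swap never both have the value \<open>z\<close>.\<close>

lemma card_unordered:
  fixes Q :: "nat quad set"
  assumes closed: "\<And>q. q \<in> Q \<Longrightarrow> swap q \<in> Q"
    and ne: "\<And>q. q \<in> Q \<Longrightarrow> fst (ac q) \<noteq> snd (ac q)"
    and nz: "\<And>q. q \<in> Q \<Longrightarrow> \<not> (f q = z \<and> f (swap q) = z)"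
  shows "card {g \<in> {q \<in> Q. fst (ac q) < snd (ac q)}. f g = z \<or> f (swap g) = z} = card {q \<in> Q. f q = z}"
proof -
  define \<phi> where "\<phi> q = (if fst (ac q) < snd (ac q) then q else swap q)" for q :: "nat quad"
  have ss: "swap (swap q) = q" "ac (swap q) = (snd (ac q), fst (ac q))" for q :: "nat quad"
    by (cases q; simp)+
  have "bij_betw \<phi> {q \<in> Q. f q = z} {g \<in> {q \<in> Q. fst (ac q) < snd (ac q)}. f g = z \<or> f (swap g) = z}"
  proof (rule bij_betw_imageI)
    show "inj_on \<phi> {q \<in> Q. f q = z}"
    proof (rule inj_onI)
      fix p q assume pq: "p \<in> {q \<in> Q. f q = z}" "q \<in> {q \<in> Q. f q = z}" "\<phi> p = \<phi> q"
      have "p = q \<or> p = swap q" using pq(3) ss(1) by (metis \<phi>_def)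
      then show "p = q" using pq nz[of q] by fastforce
    qed
    show "\<phi> ` {q \<in> Q. f q = z} = {g \<in> {q \<in> Q. fst (ac q) < snd (ac q)}. f g = z \<or> f (swap g) = z}"
    proof (intro equalityI subsetI)
      fix g assume "g \<in> \<phi> ` {q \<in> Q. f q = z}"
      then obtain q where q: "q \<in> Q" "f q = z" "g = \<phi> q" by auto
      then show "g \<in> {g \<in> {q \<in> Q. fst (ac q) < snd (ac q)}. f g = z \<or> f (swap g) = z}"
        using closed[OF q(1)] ne[OF q(1)] by (auto simp: \<phi>_def ss)
    next
      fix g assume "g \<in> {g \<in> {q \<in> Q. fst (ac q) < snd (ac q)}. f g = z \<or> f (swap g) = z}"
      then have g: "g \<in> Q" "fst (ac g) < snd (ac g)" "f g = z \<or> f (swap g) = z" by auto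
      have "g = \<phi> g" "g = \<phi> (swap g)" using g(2) by (auto simp: \<phi>_def ss)
      then show "g \<in> \<phi> ` {q \<in> Q. f q = z}" using g(1,3) closed by blast
    qed
  qed
  then show ?thesis by (simp add: bij_betw_same_card)
qed

lemma CM_imp_CMDRR:
  assumes "CM n k"
  shows "\<exists>Sp G. is_CMDRR n k Sp G"
proof -
  obtain M K \<mu> \<nu> where K: "K \<subseteq> {..<n}" "card K = k"
    and r: "rival ({..<n} - K) \<mu>" "rival ({..<n} - K) \<nu>"
    and M: "sched M (mw_target {..<n} K) (opp_target {..<n} K \<mu>) (opp_target {..<n} K \<nu>)"
    using assms unfolding CM_def is_cm_def by blast
  define Q where "Q = set_mset M"
  \<comment> \<open>The multiset is a set: every copy of \<open>q\<close> adds to the count of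
    \<open>ab q\<close>, which is at most 1.\<close>
  have M1: "count M q = 1" if "q \<in> Q" for q
  proof -
    have "{q} \<subseteq> ab -` {ab q} \<inter> set_mset M" using that by (auto simp: Q_def)
    then have "sum (count M) {q} \<le> count (image_mset ab M) (ab q)"
      unfolding count_image_mset by (intro sum_mono2) auto
    also have "\<dots> \<le> 1" using M by (simp add: sched_def mw_target_def)
    finally show ?thesis using that by (simp add: Q_def) (metis One_nat_def Suc_leI count_greater_zero_iff le_antisym)
  qed
  have cnt: "card {q \<in> Q. f q = z} = count (image_mset f M) z" for f :: "nat quad \<Rightarrow> nat \<times> nat" and z
  proof -
    have "count (image_mset f M) z = sum (count M) {q \<in> Q. f q = z}"
      unfolding count_image_mset by (rule sum.cong) (auto simp: Q_def)
    also have "\<dots> = card {q \<in> Q. f q = z}" using M1 by (simp)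
    finally show ?thesis ..
  qed
  have fin: "finite Q" by (simp add: Q_def)
  have cn: "card {q \<in> Q. ab q = z} = mw_target {..<n} K z" "card {q \<in> Q. ad q = z} = mw_target {..<n} K z"
    "card {q \<in> Q. ac q = z} = opp_target {..<n} K \<mu> z" "card {q \<in> Q. bd q = z} = opp_target {..<n} K \<nu> z" for z
    using M by (simp_all add: cnt sched_def)
  have nz: "0 < mw_target {..<n} K (ab q) \<and> 0 < mw_target {..<n} K (ad q) \<and>
      0 < opp_target {..<n} K \<mu> (ac q) \<and> 0 < opp_target {..<n} K \<nu> (bd q)" if "q \<in> Q" for q
  proof -
    have "0 < card {q' \<in> Q. f q' = f q}" for f :: "nat quad \<Rightarrow> nat \<times> nat"
      unfolding card_gt_0_iff using that fin by (cases q) auto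
    from this[of ab] this[of ad] this[of ac] this[of bd] show ?thesis by (simp add: cn)
  qed
  have closed: "swap q \<in> Q" if "q \<in> Q" for q
    using M that unfolding Q_def sched_def by (metis imageI set_image_mset)
  have ne: "fst (ac q) \<noteq> snd (ac q)" "fst (bd q) \<noteq> snd (bd q)" if "q \<in> Q" for q
    using nz[OF that] by (auto simp: opp_target_def split: if_splits)
  have wf: "wf_game n q" if "q \<in> Q" for q
    using nz[OF that] ne[OF that] nz[OF closed[OF that]]
    by (cases q) (auto simp: wf_game_def mw_target_def opp_target_def split: if_splits)
  define G where "G = {q \<in> Q. fst (ac q) < snd (ac q)}"
  define Sp where "Sp = (\<lambda>x. (x, x)) ` K"
  have GQ: "g \<in> Q" if "g \<in> G" for g using that by (simp add: G_def)
  have d: "\<not> (ab q = z \<and> ab (swap q) = z)" "\<not> (ad q = z \<and> ad (swap q) = z)"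
    "\<not> (ac q = z \<and> ac (swap q) = z)" "\<not> (bd q = z \<and> bd (swap q) = z)" if "q \<in> Q" for q z
    using ne[OF that] by (cases q; auto)+
  have pc: "partner_count G m w = mw_target {..<n} K (m, w)" for m w
  proof -
    have "partner_count G m w = card {g \<in> G. ab g = (m, w) \<or> ab (swap g) = (m, w)}"
      unfolding partner_count_def by (rule arg_cong[of _ _ card]) auto
    also have "\<dots> = card {q \<in> Q. ab q = (m, w)}"
      unfolding G_def by (rule card_unordered) (use closed ne(1) d(1) in blast)+
    finally show ?thesis by (simp add: cn)
  qed
  have oc: "mw_opp_count G m w = mw_target {..<n} K (m, w)" for m w
  proof -
    have "mw_opp_count G m w = card {g \<in> G. ad g = (m, w) \<or> ad (swap g) = (m, w)}"
      unfolding mw_opp_count_def by (rule arg_cong[of _ _ card]) auto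
    also have "\<dots> = card {q \<in> Q. ad q = (m, w)}"
      unfolding G_def by (rule card_unordered) (use closed ne(1) d(2) in blast)+
    finally show ?thesis by (simp add: cn)
  qed
  have mc: "men_opp_count G m w = opp_target {..<n} K \<mu> (m, w)" for m w
  proof -
    have "men_opp_count G m w = card {g \<in> G. ac g = (m, w) \<or> ac (swap g) = (m, w)}"
      unfolding men_opp_count_def by (rule arg_cong[of _ _ card]) auto
    also have "\<dots> = card {q \<in> Q. ac q = (m, w)}"
      unfolding G_def by (rule card_unordered) (use closed ne(1) d(3) in blast)+
    finally show ?thesis by (simp add: cn)
  qed
  have wc: "women_opp_count G m w = opp_target {..<n} K \<nu> (m, w)" for m w
  proof -
    have "women_opp_count G m w = card {g \<in> G. bd g = (m, w) \<or> bd (swap g) = (m, w)}"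
      unfolding women_opp_count_def by (rule arg_cong[of _ _ card]) auto
    also have "\<dots> = card {q \<in> Q. bd q = (m, w)}"
      unfolding G_def by (rule card_unordered) (use closed ne(1) d(4) in blast)+
    finally show ?thesis by (simp add: cn)
  qed
  have sp: "fst ` Sp = K" "snd ` Sp = K" by (auto simp: Sp_def image_image)
  have two: "\<exists>m'<n. m' \<noteq> m \<and> m' \<notin> K \<and> opp_target {..<n} K \<alpha> (m, m') = 2 \<and>
        (\<forall>m''<n. m'' \<noteq> m \<and> m'' \<noteq> m' \<longrightarrow> opp_target {..<n} K \<alpha> (m, m'') = 1)"
    if "rival ({..<n} - K) \<alpha>" "m < n" "m \<notin> K" for \<alpha> m
  proof -
    have "\<alpha> m < n \<and> \<alpha> m \<notin> K \<and> \<alpha> m \<noteq> m" using that by (auto simp: rival_def)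
    then show ?thesis using that(2,3) by (intro exI[of _ "\<alpha> m"]) (auto simp: opp_target_def)
  qed
  have "is_CMDRR n k Sp G"
    unfolding is_CMDRR_def sp pc oc mc wc
  proof (intro conjI)
    show "finite G" using fin by (simp add: G_def)
    show "\<forall>g\<in>G. wf_game n g" using wf GQ by blast
    show "spouse_matching n k Sp"
      using K by (auto simp: spouse_matching_def Sp_def card_image inj_on_def)
    show "\<forall>(m, w)\<in>Sp. \<forall>g\<in>G. \<not> (m \<in> men_of g \<and> w \<in> women_of g)"
    proof -
      \<comment> \<open>Spouses \<open>(x, x)\<close> meeting in a game would show up in column
        \<open>ab\<close> or \<open>ad\<close> of the game or of its swap, where
        \<open>mw_target\<close> is 0.\<close>
      have False if "x \<in> K" "g \<in> Q" "x \<in> men_of g" "x \<in> women_of g" for x g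
        using nz[OF that(2)] nz[OF closed[OF that(2)]] that
        by (cases g) (auto simp: mw_target_def men_of_def women_of_def split: if_splits)
      then show ?thesis unfolding Sp_def using GQ by fast
    qed
    show "\<forall>m<n. \<forall>w<n. (m, w) \<notin> Sp \<longrightarrow> mw_target {..<n} K (m, w) = 1 \<and> mw_target {..<n} K (m, w) = 1"
      by (auto simp: mw_target_def Sp_def)
    show "\<forall>m\<in>K. \<forall>m'<n. m' \<noteq> m \<longrightarrow> opp_target {..<n} K \<mu> (m, m') = 1"
      "\<forall>m\<in>K. \<forall>m'<n. m' \<noteq> m \<longrightarrow> opp_target {..<n} K \<nu> (m, m') = 1"
      using K by (auto simp: opp_target_def)
    show "\<forall>m<n. m \<notin> K \<longrightarrow> (\<exists>m'<n. m' \<noteq> m \<and> m' \<notin> K \<and> opp_target {..<n} K \<mu> (m, m') = 2 \<and>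
        (\<forall>m''<n. m'' \<noteq> m \<and> m'' \<noteq> m' \<longrightarrow> opp_target {..<n} K \<mu> (m, m'') = 1))"
      using two[OF r(1)] by blast
    show "\<forall>m<n. m \<notin> K \<longrightarrow> (\<exists>m'<n. m' \<noteq> m \<and> m' \<notin> K \<and> opp_target {..<n} K \<nu> (m, m') = 2 \<and>
        (\<forall>m''<n. m'' \<noteq> m \<and> m'' \<noteq> m' \<longrightarrow> opp_target {..<n} K \<nu> (m, m'') = 1))"
      using two[OF r(2)] by blast
  qed
  then show ?thesis by blast
qed

section \<open>Frames from cyclic starters\<close>

definition with_swaps :: "'a quad list \<Rightarrow> 'a quad list" where "with_swaps B = B @ map swap B"

lemma swap_with_swaps: "image_mset swap (mset (with_swaps B)) = mset (with_swaps B)"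
proof -
  have "swap \<circ> swap = (id :: 'a quad \<Rightarrow> 'a quad)" by (auto simp: fun_eq_iff)
  then show ?thesis by (simp add: with_swaps_def multiset.map_comp add.commute flip: mset_map)
qed

definition shift :: "nat \<Rightarrow> nat \<Rightarrow> nat \<Rightarrow> nat" where
  "shift v s x = (if x < v then (x + s) mod v else x)"

text \<open>The points are the residues modulo \<open>v\<close> and \<open>u\<close> points \<open>v, \<dots>, v + u - 1\<close> fixed by all shifts.
  The code numbers the orbits of pairs of points; it is 0 both for the diagonal and for every pair
  of fixed points, which no game may contain.\<close>

definition orbit_code :: "nat \<Rightarrow> nat \<Rightarrow> nat \<times> nat \<Rightarrow> nat" where
  "orbit_code v u z = (case z of (x, y) \<Rightarrow>
     if x < v then (if y < v then (y + v - x) mod v else y)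
     else if y < v then v + u + x else 0)"

text \<open>The holes are the residue classes modulo \<open>t\<close> and the set of fixed points,
  so differences divisible by \<open>t\<close> must not occur. The three ranges are the codes of
  pairs (residue, residue), (residue, fixed) and (fixed, residue). The list is increasing, so
  equality with a sorted list says that each of these orbits occurs once.\<close>

definition orbit_codes :: "nat \<Rightarrow> nat \<Rightarrow> nat \<Rightarrow> nat list" where
  "orbit_codes v t u = filter (\<lambda>d. d mod t \<noteq> 0) [0..<v] @ [v..<v + u] @ [v + u + v..<v + u + (v + u)]"

definition cyclic_base :: "nat \<Rightarrow> nat \<Rightarrow> nat \<Rightarrow> nat quad list \<Rightarrow> bool" where
  "cyclic_base v t u B \<longleftrightarrow> list_all (\<lambda>(a,b,c,d). a < v + u \<and> b < v + u \<and> c < v + u \<and> d < v + u) B \<and>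
     list_all (\<lambda>f. sort (map (\<lambda>q. orbit_code v u (f q)) (with_swaps B)) = orbit_codes v t u) [ab, ad, ac, bd]"

lemma mod_less_double: "p < 2 * v \<Longrightarrow> p mod v = (if p < v then p else p - v)" for p v :: nat
  by (simp add: mod_if)

text \<open>A pair with nonzero code contains a residue, and this residue determines the shift.
  Hence each pair of the orbit is reached from \<open>(a, b)\<close> by exactly one shift, and a
  pair with another code by none.\<close>

lemma card_shift:
  assumes lt: "a < v + u" "b < v + u" "x < v + u" "y < v + u" and nz: "orbit_code v u (a, b) \<noteq> 0"
  shows "(\<Sum>s<v. if (shift v s a, shift v s b) = (x, y) then 1 else 0) =
     (if orbit_code v u (a, b) = orbit_code v u (x, y) then 1 else (0 :: nat))"
proof -
  have *: "(\<Sum>s<v. if P s then 1 else (0::nat)) = (if P s0 then 1 else 0)"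
    if "s0 < v" "\<And>s. s < v \<Longrightarrow> P s \<Longrightarrow> s = s0" for P s0
    using sum_single_index[of "{..<v}" s0 "\<lambda>s. if P s then 1 else 0"] that by fastforce
  have **: "s = (q + v - p) mod v" if "p < v" "q < v" "s < v" "(p + s) mod v = q" for p q s
    using that by (auto simp: mod_less_double split: if_splits)
  have shl: "shift v s p < v \<longleftrightarrow> p < v" for s p by (auto simp: shift_def)
  consider "a < v" "x < v" | "\<not> a < v" "b < v" "\<not> x < v" "y < v"
    | "(a < v) \<noteq> (x < v)" | "(b < v) \<noteq> (y < v)" | "\<not> a < v" "\<not> b < v" by blast
  then show ?thesis
  proof cases
    case 1
    have "(shift v ((x + v - a) mod v) b = y) \<longleftrightarrow> orbit_code v u (a, b) = orbit_code v u (x, y)"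
      using 1 lt by (auto simp: orbit_code_def shift_def mod_less_double split: if_splits)
    moreover have "shift v ((x + v - a) mod v) a = x"
      using 1 by (auto simp: shift_def mod_less_double)
    ultimately show ?thesis
      using *[of "(x + v - a) mod v" "\<lambda>s. (shift v s a, shift v s b) = (x, y)"] 1 **[of a x]
      by (simp add: shift_def)
  next
    case 2
    have "shift v ((y + v - b) mod v) b = y"
      using 2 by (auto simp: shift_def mod_less_double)
    then show ?thesis
      using *[of "(y + v - b) mod v" "\<lambda>s. (shift v s a, shift v s b) = (x, y)"] 2 **[of b y]
      by (simp add: shift_def orbit_code_def)
  next
    case 3
    then have "(shift v s a, shift v s b) \<noteq> (x, y)" for s using shl by blast
    moreover have "orbit_code v u (a, b) \<noteq> orbit_code v u (x, y)"
    proof -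
      \<comment> \<open>Pairs whose first point is a residue have codes below \<open>v + u\<close>;
        all others have code 0 or at least \<open>v + u\<close>.\<close>
      have "orbit_code v u (p, q) < v + u" if "p < v" "q < v + u" for p q
        using that by (auto simp: orbit_code_def intro: less_le_trans[OF mod_less_divisor])
      moreover have "orbit_code v u (p, q) = 0 \<or> v + u \<le> orbit_code v u (p, q)" if "\<not> p < v" for p q
        using that by (auto simp: orbit_code_def)
      ultimately show ?thesis using 3 lt nz by (metis leD)
    qed
    ultimately show ?thesis by simp
  next
    case 4
    then have "(shift v s a, shift v s b) \<noteq> (x, y)" for s using shl by blast
    moreover have "orbit_code v u (a, b) \<noteq> orbit_code v u (x, y)"
    proof (cases "a < v \<and> x < v")
      case True
      have "\<not> v \<le> p mod v" for p using True by (simp add: not_le)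
      then show ?thesis using 4 True by (auto simp: orbit_code_def not_less)
    next
      case False
      then show ?thesis using 4 lt nz
        by (auto simp: orbit_code_def split: if_splits)
    qed
    ultimately show ?thesis by simp
  next
    case 5
    then show ?thesis using nz by (simp add: orbit_code_def)
  qed
qed


lemma count_map_Cons:
  "count (mset (map f (w # L))) z = (if f w = z then 1 else 0) + count (mset (map f L)) z"
  by simp

lemma image_mset_sum: "image_mset f (\<Sum>i\<in>I. X i) = (\<Sum>i\<in>I. image_mset f (X i))"
  by (induction I rule: infinite_finite_induct) simp_all

lemma count_develop:
  assumes L: "\<And>w. w \<in> set L \<Longrightarrow> fst w < v + u \<and> snd w < v + u \<and> orbit_code v u w \<noteq> 0"
    and z: "fst z < v + u" "snd z < v + u"
  shows "(\<Sum>s<v. count (mset (map (map_prod (shift v s) (shift v s)) L)) z) =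
     count (mset (map (orbit_code v u) L)) (orbit_code v u z)"
  using L
proof (induction L)
  case (Cons w L)
  obtain a b x y where wz: "w = (a, b)" "z = (x, y)" by fastforce
  have "(\<Sum>s<v. if map_prod (shift v s) (shift v s) w = z then 1 else 0) =
     (if orbit_code v u w = orbit_code v u z then 1 else (0 :: nat))"
    using card_shift[of a v u b x y] Cons.prems[of w] z by (simp add: wz)
  moreover have "(\<Sum>s<v. count (mset (map (map_prod (shift v s) (shift v s)) L)) z) =
     count (mset (map (orbit_code v u) L)) (orbit_code v u z)"
    by (rule Cons.IH) (use Cons.prems in simp)
  ultimately show ?case by (simp only: count_map_Cons sum.distrib)
qed simp

text \<open>The base games and their swaps are developed through all shifts. In each column the base
  list meets every orbit of pairs across two holes once and no other orbit, so developing covers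
  exactly the pairs across holes, each once.\<close>

lemma Fr_cyclic:
  assumes base: "cyclic_base (h * t) t u B" and pos: "0 < h * t"
  shows "Fr (replicate t h @ [u])"
proof -
  define v where "v = h * t"
  have B: "cyclic_base v t u B" and t: "t dvd v" "v > 0" and h: "v div t = h"
    using base pos by (simp_all add: v_def)
  let ?n = "v + u"
  define lab where "lab x = (if x < v then x mod t else t)" for x
  define M where "M = (\<Sum>s<v. image_mset (map_quad (shift v s)) (mset (with_swaps B)))"
  have t0: "t > 0" using t by (auto intro: Nat.gr0I)
  have key: "count (image_mset f M) = frame_on {..<?n} lab"
    if eq: "\<And>g q. f (map_quad g q) = map_prod g g (f q)"
      and lt: "\<And>q. q \<in> set (with_swaps B) \<Longrightarrow> fst (f q) < ?n \<and> snd (f q) < ?n"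
      and srt: "sort (map (\<lambda>q. orbit_code v u (f q)) (with_swaps B)) = orbit_codes v t u" for f
  proof
    fix z
    let ?L = "map f (with_swaps B)"
    have L: "fst w < ?n \<and> snd w < ?n" if "w \<in> set ?L" for w using that lt by auto
    have ms: "mset (map (orbit_code v u) ?L) = mset (orbit_codes v t u)"
      unfolding srt[symmetric] by (simp add: o_def)
    then have st: "set (map (orbit_code v u) ?L) = set (orbit_codes v t u)" by (metis set_mset_mset)
    have "0 \<notin> set (orbit_codes v t u)" using t by (auto simp: orbit_codes_def)
    then have L0: "orbit_code v u w \<noteq> 0" if "w \<in> set ?L" for w using that st by (metis image_eqI set_map)
    have dist: "distinct (orbit_codes v t u)" by (auto simp: orbit_codes_def)
    have M: "count (image_mset f M) z = (\<Sum>s<v. count (mset (map (map_prod (shift v s) (shift v s)) ?L)) z)"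
      unfolding M_def by (simp add: image_mset_sum count_sum multiset.map_comp o_def eq)
    show "count (image_mset f M) z = frame_on {..<?n} lab z"
    proof (cases "fst z < ?n \<and> snd z < ?n")
      case True
      obtain x y where z: "z = (x, y)" by fastforce
      have "count (image_mset f M) z = count (mset (orbit_codes v t u)) (orbit_code v u z)"
        unfolding M ms[symmetric] by (rule count_develop) (use L L0 True in auto)
      also have "\<dots> = (if orbit_code v u z \<in> set (orbit_codes v t u) then 1 else 0)"
        using dist by (simp add: distinct_count_atmost_1)
      also have "orbit_code v u z \<in> set (orbit_codes v t u) \<longleftrightarrow> lab x \<noteq> lab y"
      proof (cases "x < v \<and> y < v")
        case True
        have "(y + v - x) mod v mod t = 0 \<longleftrightarrow> x mod t = y mod t"
        proof -
          have "(y + v - x) mod v mod t = (y + v - x) mod t" using t by (simp add: mod_mod_cancel)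
          also have "\<dots> = 0 \<longleftrightarrow> (y + v) mod t = x mod t"
            using True by (metis dvd_eq_mod_eq_0 mod_eq_dvd_iff_nat le_add2 le_trans less_imp_le)
          also have "(y + v) mod t = y mod t" using t by (metis dvd_imp_mod_0 mod_add_right_eq add.right_neutral)
          finally show ?thesis by auto
        qed
        then obtain d where "orbit_code v u z = d" "d < v" "d mod t = 0 \<longleftrightarrow> x mod t = y mod t"
          using True t by (simp add: z orbit_code_def)
        then show ?thesis using True by (auto simp: orbit_codes_def lab_def)
      next
        case False
        have "p mod t \<noteq> t" for p using t0 by (metis mod_less_divisor nat_neq_iff)
        then show ?thesis using False \<open>fst z < ?n \<and> snd z < ?n\<close> t
          by (auto simp: z orbit_code_def orbit_codes_def lab_def dest: sym)
      qed
      finally show ?thesis using True by (auto simp: frame_on_def z)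
    next
      case False
      have sh: "shift v s p < ?n" if "p < ?n" for s p
        using that t by (auto simp: shift_def intro: less_le_trans[OF mod_less_divisor])
      have "z \<notin> set (map (map_prod (shift v s) (shift v s)) ?L)" for s
      proof
        assume "z \<in> set (map (map_prod (shift v s) (shift v s)) ?L)"
        then obtain w where "z = map_prod (shift v s) (shift v s) w" "w \<in> set ?L"
          unfolding set_map[of "map_prod (shift v s) (shift v s)"] by (rule imageE)
        then show False using False L[of w] sh by (cases w) simp
      qed
      then have "count (mset (map (map_prod (shift v s) (shift v s)) ?L)) z = 0" for s
        by (metis count_eq_zero_iff set_mset_mset)
      then show ?thesis unfolding M using False by (auto simp: frame_on_def)
    qed
  qed
  have lt: "a < ?n \<and> b < ?n \<and> c < ?n \<and> d < ?n" if "(a, b, c, d) \<in> set (with_swaps B)" for a b c d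
    using that B by (fastforce simp: cyclic_base_def with_swaps_def list_all_iff)
  have srt: "sort (map (\<lambda>q. orbit_code v u (f q)) (with_swaps B)) = orbit_codes v t u"
    if "f \<in> {ab, ad, ac, bd}" for f
    using B that by (auto simp: cyclic_base_def)
  have "image_mset swap M = M"
    unfolding M_def by (subst (2) swap_with_swaps[symmetric])
      (simp only: image_mset_sum multiset.map_comp o_def map_quad_swap)
  then have "is_frame {..<?n} lab M"
    unfolding is_frame_def sched_def
    by (intro conjI key map_quad_proj srt) (auto dest: lt)
  then have "Fr (replicate t (v div t) @ [u])"
  proof (rule FrI)
    show "lab ` {..<?n} \<subseteq> {..<length (replicate t (v div t) @ [u])}"
      using t0 by (auto simp: lab_def less_Suc_eq)
    fix i assume "i < length (replicate t (v div t) @ [u])"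
    then consider "i < t" | "i = t" by fastforce
    then show "card {x \<in> {..<?n}. lab x = i} = (replicate t (v div t) @ [u]) ! i"
    proof cases
      case 1
      obtain h where h: "v = t * h" using t by auto
      have "{x \<in> {..<?n}. lab x = i} = (\<lambda>j. i + t * j) ` {..<h}"
      proof (intro equalityI subsetI)
        fix x assume "x \<in> {x \<in> {..<?n}. lab x = i}"
        then have "x < t * h" "x mod t = i" using 1 h by (auto simp: lab_def split: if_splits)
        then show "x \<in> (\<lambda>j. i + t * j) ` {..<h}"
          by (intro image_eqI[of _ _ "x div t"]) (auto simp: less_mult_imp_div_less mult.commute)
      next
        fix x assume "x \<in> (\<lambda>j. i + t * j) ` {..<h}"
        then obtain j where j: "j < h" "x = i + t * j" by auto
        have "x < t + t * j" using 1 j by simp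
        also have "\<dots> \<le> t * h" using j by (metis Suc_leI mult_Suc_right mult_le_mono2)
        finally show "x \<in> {x \<in> {..<?n}. lab x = i}" using 1 j h by (simp add: lab_def)
      qed
      moreover have "inj_on (\<lambda>j. i + t * j) {..<h}" using t0 by (auto simp: inj_on_def)
      ultimately show ?thesis using 1 t0 h by (simp add: card_image nth_append)
    next
      case 2
      have "p mod t \<noteq> t" for p using t0 by (metis mod_less_divisor nat_neq_iff)
      then have "{x \<in> {..<?n}. lab x = i} = {v..<?n}" using 2 by (auto simp: lab_def)
      then show ?thesis using 2 by (simp add: nth_append)
    qed
  qed simp
  then show ?thesis by (simp only: h)
qed

section \<open>Explicit lists of games\<close>

text \<open>A pair \<open>(x, y)\<close> becomes the number \<open>x * n + y\<close>, repeated as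
  often as prescribed. The list comes out sorted, so comparing it with the sorted codes of a column
  turns an equality of multisets into an evaluation.\<close>

definition pair_codes :: "nat \<Rightarrow> (nat \<times> nat \<Rightarrow> nat) \<Rightarrow> nat list" where
  "pair_codes n T = concat (map (\<lambda>i. replicate (T (i div n, i mod n)) i) [0..<n * n])"

definition explicit_sched :: "nat \<Rightarrow> nat quad list \<Rightarrow> (nat \<times> nat \<Rightarrow> nat) \<Rightarrow> (nat \<times> nat \<Rightarrow> nat) \<Rightarrow> bool" where
  "explicit_sched n B P U \<longleftrightarrow> list_all (\<lambda>(a,b,c,d). a < n \<and> b < n \<and> c < n \<and> d < n) B \<and>
     list_all (\<lambda>(f, T). sort (map (\<lambda>q. fst (f q) * n + snd (f q)) (with_swaps B)) = pair_codes n T)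
       [(ab, P), (ad, P), (ac, U), (bd, U)]"

lemma count_pair_codes: "count (mset (pair_codes n T)) i = (if i < n * n then T (i div n, i mod n) else 0)"
proof -
  have "count (mset (concat (map (\<lambda>i. replicate (g i) i) [0..<m]))) i = (if i < m then g i else 0)" for g :: "nat \<Rightarrow> nat" and m
    by (induction m) auto
  then show ?thesis unfolding pair_codes_def .
qed

lemma explicit_sched:
  assumes B: "explicit_sched n B P U"
    and P: "\<And>z. z \<notin> {..<n} \<times> {..<n} \<Longrightarrow> P z = 0" and U: "\<And>z. z \<notin> {..<n} \<times> {..<n} \<Longrightarrow> U z = 0"
  shows "sched (mset (with_swaps B)) P U U"
proof -
  have key: "count (image_mset f (mset (with_swaps B))) = T"
    if lt: "\<And>q. q \<in> set (with_swaps B) \<Longrightarrow> fst (f q) < n \<and> snd (f q) < n"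
      and srt: "sort (map (\<lambda>q. fst (f q) * n + snd (f q)) (with_swaps B)) = pair_codes n T"
      and T: "\<And>z. z \<notin> {..<n} \<times> {..<n} \<Longrightarrow> T z = 0" for f T
  proof
    fix z :: "nat \<times> nat"
    let ?N = "image_mset f (mset (with_swaps B))" and ?c = "\<lambda>w. fst w * n + snd w"
    have sub: "set_mset ?N \<subseteq> {..<n} \<times> {..<n}" 
    proof
      fix w assume "w \<in># ?N"
      then obtain q where "q \<in> set (with_swaps B)" "w = f q" by (metis imageE set_image_mset set_mset_mset)
      then show "w \<in> {..<n} \<times> {..<n}" using lt[of q] by (simp add: mem_Times_iff)
    qed
    show "count ?N z = T z"
    proof (cases "z \<in> {..<n} \<times> {..<n}")
      case True
      then have z: "?c z div n = fst z" "?c z mod n = snd z" "fst z < n" "snd z < n" by (simp_all add: mem_Times_iff)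
      have "?c z < Suc (fst z) * n" using z(4) by simp
      also have "\<dots> \<le> n * n" using z(3) by (intro mult_le_mono1) simp
      finally have "?c z < n * n" .
      have "inj_on ?c ({..<n} \<times> {..<n})"
      proof (rule inj_onI)
        fix p q assume pq: "p \<in> {..<n} \<times> {..<n}" "q \<in> {..<n} \<times> {..<n}" "?c p = ?c q"
        have "p = (?c p div n, ?c p mod n)" "q = (?c q div n, ?c q mod n)"
          using pq(1,2) by (simp_all add: mem_Times_iff prod_eq_iff)
        then show "p = q" using pq(3) by metis
      qed
      then have "count ?N z = count (image_mset ?c ?N) (?c z)"
        using count_image_mset_inj_on[OF _ True sub, of ?c] by simp
      also have "image_mset ?c ?N = mset (pair_codes n T)"
        unfolding srt[symmetric] by (simp add: multiset.map_comp o_def)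
      also have "count \<dots> (?c z) = T z" using \<open>?c z < n * n\<close> z by (simp add: count_pair_codes)
      finally show ?thesis .
    next
      case False
      then have "z \<notin># ?N" using sub by blast
      then show ?thesis using T[OF False] by (simp only: not_in_iff)
    qed
  qed
  have lt: "a < n \<and> b < n \<and> c < n \<and> d < n" if "(a, b, c, d) \<in> set (with_swaps B)" for a b c d
    using that B by (fastforce simp: explicit_sched_def with_swaps_def list_all_iff)
  show ?thesis unfolding sched_def
    by (intro conjI swap_with_swaps key) (use B P U in \<open>auto simp: explicit_sched_def dest: lt\<close>)
qed

text \<open>From \<open>k\<close> on this exchanges \<open>k + 2 * i\<close> and
  \<open>k + 2 * i + 1\<close>. In an explicit list the couples have the labels below
  \<open>k\<close>, and the unmarried players of either sex are paired off consecutively.\<close>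

definition twin :: "nat \<Rightarrow> nat \<Rightarrow> nat" where
  "twin k x = (if even (x - k) then x + 1 else x - 1)"

definition explicit_CM :: "nat \<Rightarrow> nat \<Rightarrow> nat quad list \<Rightarrow> bool" where
  "explicit_CM n k B \<longleftrightarrow> explicit_sched n B
     (\<lambda>(x, y). if x < n \<and> y < n \<and> (x = y \<longrightarrow> k \<le> x) then 1 else 0)
     (\<lambda>(x, y). if x < n \<and> y < n \<and> x \<noteq> y then (if k \<le> x \<and> y = twin k x then 2 else 1) else 0)"

lemma CM_explicit:
  assumes "explicit_CM n k B" "k \<le> n" "even (n - k)"
  shows "CM n k"
proof -
  have "rival ({..<n} - {..<k}) (twin k)"
    using assms(2,3) by (auto simp: rival_def twin_def) presburger+
  moreover have "sched (mset (with_swaps B)) (mw_target {..<n} {..<k})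
      (opp_target {..<n} {..<k} (twin k)) (opp_target {..<n} {..<k} (twin k))"
    using explicit_sched[OF assms(1)[unfolded explicit_CM_def]]
    by (rule sched_cong) (auto simp: mw_target_def opp_target_def split: prod.splits)
  ultimately show ?thesis unfolding CM_def is_cm_def using assms(2)
    by (intro exI[of _ "mset (with_swaps B)"] exI[of _ "{..<k}"] exI[of _ "twin k"]) auto
qed

definition explicit_pairs :: "nat \<Rightarrow> nat quad list \<Rightarrow> bool" where
  "explicit_pairs n B \<longleftrightarrow> (let T = (\<lambda>(x, y). if x < n \<and> y < n \<and> x div 2 \<noteq> y div 2 then 1 else 0) in
     explicit_sched n B T T)"

text \<open>The holes are the fibres of \<open>x div 2\<close>; for \<open>j = 1\<close> the last
  point has no companion and forms the last hole, for \<open>j = 0\<close> that hole is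
  empty.\<close>

lemma Fr_explicit:
  assumes "explicit_pairs (2 * t + j) B" "j < 2"
  shows "Fr (replicate t 2 @ [j])"
proof -
  define n where "n = 2 * t + j"
  have tj: "n div 2 = t" "n mod 2 = j" using assms(2) by (simp_all add: n_def)
  have "is_frame {..<n} (\<lambda>x. x div 2) (mset (with_swaps B))"
    unfolding is_frame_def
    using explicit_sched[OF assms(1)[folded n_def, unfolded explicit_pairs_def Let_def]]
    by (rule sched_cong) (auto simp: frame_on_def split: prod.splits)
  then have "Fr (replicate (n div 2) 2 @ [n mod 2])"
  proof (rule FrI)
    show "(\<lambda>x. x div 2) ` {..<n} \<subseteq> {..<length (replicate (n div 2) 2 @ [n mod 2])}" by auto
    fix i assume "i < length (replicate (n div 2) 2 @ [n mod 2])"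
    then have i: "i \<le> n div 2" by simp
    have "{x \<in> {..<n}. x div 2 = i} = {2 * i..<min n (2 * i + 2)}" by auto
    then have c: "card {x \<in> {..<n}. x div 2 = i} = min n (2 * i + 2) - 2 * i" by simp
    show "card {x \<in> {..<n}. x div 2 = i} = (replicate (n div 2) 2 @ [n mod 2]) ! i"
    proof (cases "i < n div 2")
      case True
      then have "min n (2 * i + 2) = 2 * i + 2" by linarith
      then show ?thesis using True c by (simp add: nth_append)
    next
      case False
      then have "i = n div 2" using i by simp
      moreover from this have "min n (2 * i + 2) - 2 * i = n mod 2" by presburger
      ultimately show ?thesis using c by (simp add: nth_append)
    qed
  qed simp
  then show ?thesis by (simp only: tj)
qed

section \<open>Filling holes\<close>

lemma CM_0_0: "CM 0 0"
  unfolding CM_def is_cm_def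
  by (intro exI[of _ "{#}"] exI[of _ "{}"] exI[of _ id])
    (auto simp: rival_def sched_def mw_target_def opp_target_def fun_eq_iff)

lemma CM_1_1: "CM 1 1"
  unfolding CM_def is_cm_def
  by (intro exI[of _ "{#}"] exI[of _ "{0}"] exI[of _ id])
    (auto simp: rival_def sched_def mw_target_def opp_target_def fun_eq_iff)

lemma Fr_fill_list: "Fr hs \<Longrightarrow> list_all2 CM hs ks \<Longrightarrow> CM (sum_list hs) (sum_list ks)"
  by (rule Fr_fill) (auto simp: list_all2_conv_all_nth)

lemma Fr_fill_replicate:
  assumes "Fr (replicate t h @ [u])" "CM h a" "CM h b" "CM u c" "j \<le> t"
  shows "CM (t * h + u) (j * a + (t - j) * b + c)"
proof -
  have "list_all2 CM (replicate j h @ replicate (t - j) h @ [u]) (replicate j a @ replicate (t - j) b @ [c])"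
    using assms by (intro list_all2_appendI) (auto simp: list_all2_conv_all_nth)
  moreover have "replicate j h @ replicate (t - j) h = replicate t h"
    using assms(5) by (metis le_add_diff_inverse replicate_add)
  ultimately show ?thesis
    using Fr_fill_list[OF assms(1), of "replicate j a @ replicate (t - j) b @ [c]"]
    by (simp add: sum_list_replicate append_assoc[symmetric] del: append_assoc)
qed

section \<open>Frames from truncated transversal designs\<close>

lemma Fr_append_zeros: "Fr (hs @ replicate z 0) \<longleftrightarrow> Fr hs"
proof (induction z)
  case (Suc z)
  have "hs @ replicate (Suc z) 0 = (hs @ replicate z 0) @ [0]"
    by (simp only: replicate_Suc replicate_append_same append_assoc)
  then show ?case using Suc by (simp only: Fr_append_0)
qed simp

lemma sum_two: "r \<le> m \<Longrightarrow> (\<Sum>x<m. if x < r then 2 else 0) = 2 * (r :: nat)"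
  by (induction m) (auto simp: le_Suc_eq)

lemma sum_three:
  "(\<Sum>x<m. if x < u div 3 then 3 else if x = u div 3 then u mod 3 else 0) = min (3 * m) (u :: nat)"
  by (induction m) (auto simp: min_def)

definition group_weight :: "nat \<Rightarrow> nat \<Rightarrow> nat" where "group_weight r x = (if x < r then 2 else 0)"
text \<open>The size \<open>u\<close> of the last hole is spent greedily over the points of the last
  group: weight 3 while possible, then one remainder, then 0.\<close>

definition last_weight :: "nat \<Rightarrow> nat \<Rightarrow> nat" where
  "last_weight u x = (if x < u div 3 then 3 else if x = u div 3 then u mod 3 else 0)"

text \<open>The nonempty holes needed on a block are 4 to 6 of size 2 and at most one more, of size
  at most 3; these are the ingredients \<open>ing\<close>.\<close>

lemma Fr_truncated_TD:
  assumes ing: "\<And>s j. s \<in> {4, 5, 6} \<Longrightarrow> j \<le> 3 \<Longrightarrow> Fr (replicate s 2 @ [j])"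
  assumes td: "TD (5 + length rs) m" and rs: "length rs \<le> 2" "\<And>r. r \<in> set rs \<Longrightarrow> r \<le> m" and u: "u \<le> 3 * m"
  shows "Fr (replicate 4 (2 * m) @ map ((*) 2) rs @ [u])"
proof -
  define ws where "ws = replicate 4 (\<lambda>_. 2) @ map group_weight rs @ [last_weight u]"
  have sums: "map (\<lambda>w. \<Sum>x<m. w x) ws = replicate 4 (2 * m) @ map ((*) 2) rs @ [u]"
    using rs(2) u by (simp add: ws_def group_weight_def last_weight_def sum_two sum_three)
  have part: "Fr (replicate 4 2 @ as @ [j])" if "length as \<le> 2" "set as \<subseteq> {0, 2}" "j \<le> 3" for as j
  proof -
    define s where "s = length (filter ((=) 2) as)"
    have "s \<le> 2" using that(1) by (metis s_def length_filter_le order_trans)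
    then have "Fr (replicate (4 + s) 2 @ [j])" using ing[OF _ that(3), of "4 + s"] by force
    \<comment> \<open>Points of weight 0 become empty holes; a permutation then puts them in their
      places.\<close>
    then have "Fr ((replicate (4 + s) 2 @ [j]) @ replicate (length as - s) 0)"
      by (simp only: Fr_append_zeros)
    moreover have "mset as = replicate_mset s 2 + replicate_mset (length as - s) 0"
      using that(2) unfolding s_def
    proof (induction as)
      case (Cons a as)
      moreover have "length (filter ((=) 2) as) \<le> length as" by simp
      ultimately show ?case by (auto simp: Suc_diff_le)
    qed simp
    ultimately show ?thesis
      by (elim Fr_perm) (simp add: replicate_add eval_nat_numeral)
  qed
  have lw: "last_weight u x \<le> 3" for x unfolding last_weight_def by (simp add: less_imp_le)
  have gw: "group_weight r x \<in> {0, 2}" for r x by (simp add: group_weight_def)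
  have "Fr (map (\<lambda>i. (ws ! i) (c i)) [0..<length ws])" for c
  proof -
    have l: "length ws = 4 + length rs + 1" by (simp add: ws_def)
    have "map (\<lambda>i. (ws ! i) (c i)) [0..<length ws] =
      replicate 4 2 @ map (\<lambda>i. group_weight (rs ! i) (c (4 + i))) [0..<length rs] @ [last_weight u (c (4 + length rs))]"
      (is "?l = ?r")
    proof (rule nth_equalityI)
      fix i assume "i < length ?l"
      then consider "i < 4" | "4 \<le> i" "i < 4 + length rs" | "i = 4 + length rs" using l by fastforce
      then show "?l ! i = ?r ! i"
      proof cases
        case 2
        then obtain j where "i = 4 + j" "j < length rs" by (metis add_less_cancel_left le_Suc_ex)
        then show ?thesis by (simp add: ws_def nth_append)
      qed (simp_all add: ws_def nth_append)
    qed (simp add: l)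
    then show ?thesis
      using part[of "map (\<lambda>i. group_weight (rs ! i) (c (4 + i))) [0..<length rs]" "last_weight u (c (4 + length rs))"]
        rs(1) lw gw by (auto simp: image_subset_iff)
  qed
  then show ?thesis
    using Fr_wilson[of ws m] td unfolding sums by (simp add: ws_def)
qed

section \<open>Numbers of couples that a list of holes can realise\<close>

definition full :: "nat \<Rightarrow> bool" where "full n \<longleftrightarrow> (\<forall>k\<le>n. even (n - k) \<longrightarrow> CM n k)"

text \<open>If the other holes together realise everything, then a hole only needs the extreme values.\<close>

definition ends :: "nat \<Rightarrow> bool" where "ends u \<longleftrightarrow> CM u (u mod 2) \<and> CM u u"

definition spec :: "nat list \<Rightarrow> nat \<Rightarrow> bool" where
  "spec hs x \<longleftrightarrow> (\<exists>ks. list_all2 CM hs ks \<and> sum_list ks = x)"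

definition fullspec :: "nat list \<Rightarrow> bool" where
  "fullspec hs \<longleftrightarrow> (\<forall>x\<le>sum_list hs. even (sum_list hs - x) \<longrightarrow> spec hs x)"

lemma spec_Nil: "spec [] 0" by (simp add: spec_def)

lemma spec_Cons: "CM h k \<Longrightarrow> spec hs x \<Longrightarrow> spec (h # hs) (k + x)"
  unfolding spec_def by (metis list_all2_Cons sum_list.Cons)

lemma spec_append: "spec hs x \<Longrightarrow> CM h k \<Longrightarrow> spec (hs @ [h]) (x + k)"
  unfolding spec_def by (metis list_all2_appendI list_all2_Cons list_all2_Nil sum_list_append sum_list.Cons sum_list.Nil add_0_right)

lemma fullspecD: "fullspec hs \<Longrightarrow> x \<le> sum_list hs \<Longrightarrow> even (sum_list hs - x) \<Longrightarrow> spec hs x"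
  by (simp add: fullspec_def)

lemma spec_CM: "Fr hs' \<Longrightarrow> mset hs = mset hs' \<Longrightarrow> spec hs x \<Longrightarrow> CM (sum_list hs) x"
  by (metis Fr_perm Fr_fill_list spec_def)

lemma full_CM: "Fr hs' \<Longrightarrow> mset hs = mset hs' \<Longrightarrow> fullspec hs \<Longrightarrow> full (sum_list hs)"
  unfolding full_def fullspec_def using spec_CM by blast

lemma full_ends: "full u \<Longrightarrow> ends u"
  unfolding full_def ends_def by (simp add: dvd_minus_mod)

text \<open>The last hole takes its largest value if \<open>x\<close> is at least \<open>u\<close>
  and its smallest otherwise; \<open>u \<le> sum_list hs + 1\<close> closes the gap between the two
  ranges. If \<open>u\<close> and \<open>sum_list hs\<close> were both odd, \<open>x = 0\<close>
  would be asked for although an odd hole holds at least one couple.\<close>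

lemma fullspec_append_ends:
  assumes hs: "fullspec hs" and u: "ends u" "u \<le> sum_list hs + 1" and par: "even u \<or> even (sum_list hs)"
  shows "fullspec (hs @ [u])"
  unfolding fullspec_def
proof (intro allI impI)
  fix x assume "x \<le> sum_list (hs @ [u])" "even (sum_list (hs @ [u]) - x)"
  then have x: "x \<le> sum_list hs + u" "even (sum_list hs + u - x)" by simp_all
  show "spec (hs @ [u]) x"
  proof (cases "u \<le> x")
    case True
    then have "sum_list hs - (x - u) = sum_list hs + u - x" by simp
    then have "spec hs (x - u)" using x by (intro fullspecD[OF hs]) simp_all
    then show ?thesis using spec_append[of hs "x - u" u u] u True by (simp add: ends_def)
  next
    case False
    \<comment> \<open>For odd \<open>u\<close> the sum of \<open>hs\<close> is even, so
      \<open>x\<close> is odd and not 0.\<close>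
    have le: "u mod 2 \<le> x" using x par by (cases "even u") (auto simp: odd_iff_mod_2_eq_one intro: Suc_leI Nat.gr0I)
    have "x - u mod 2 \<le> sum_list hs" using False u by simp
    moreover have "even (sum_list hs - (x - u mod 2))"
    proof -
      have "sum_list hs + u - x = (sum_list hs - (x - u mod 2)) + (u - u mod 2)"
        using calculation le by (simp add: mod_less_eq_dividend)
      then show ?thesis using x(2) dvd_add_left_iff[OF dvd_minus_mod[of 2 u]] by (simp only:)
    qed
    ultimately have "spec hs (x - u mod 2)" by (rule fullspecD[OF hs])
    then show ?thesis using spec_append[of hs "x - u mod 2" u "u mod 2"] u le by (simp add: ends_def)
  qed
qed

lemma fullspec_Nil: "fullspec []" by (simp add: fullspec_def spec_Nil)

lemma fullspec_append_full:
  assumes hs: "fullspec hs" and u: "full u" and par: "even u" "even (sum_list hs)"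
  shows "fullspec (hs @ [u])"
  unfolding fullspec_def
proof (intro allI impI)
  fix x assume "x \<le> sum_list (hs @ [u])" "even (sum_list (hs @ [u]) - x)"
  then have x: "x \<le> sum_list hs + u" "even (sum_list hs + u - x)" by simp_all
  then have "even x" using par by presburger
  then have "spec hs (x - min x u)" "CM u (min x u)"
    using hs u par x by (auto simp: fullspec_def full_def min_def)
  from spec_append[OF this] show "spec (hs @ [u]) x" by simp
qed

lemma fullspec_replicate: "full h \<Longrightarrow> even h \<Longrightarrow> fullspec (replicate j h)"
proof (induction j)
  case (Suc j)
  have "fullspec (replicate j h @ [h])"
    using Suc by (intro fullspec_append_full) (simp_all add: sum_list_replicate)
  then show ?case by (simp add: replicate_append_same)
qed (simp add: fullspec_Nil)

text \<open>A last group of size 2 or 6 leaves only the largest value of \<open>k\<close> open, because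
  a CMDRR(2,2) or CMDRR(6,6) does not exist.\<close>

lemma full_but_top:
  assumes hs: "fullspec hs" "even (sum_list hs)" and fr: "Fr hs'" "mset hs' = mset (hs @ [u])"
    and u: "CM u 0" "CM u (u - 2)" "2 \<le> u" "u \<le> sum_list hs" "even u" and top: "CM n n" and n: "n = sum_list hs + u"
  shows "full n"
  unfolding full_def
proof (intro allI impI)
  fix k assume k: "k \<le> n" "even (n - k)"
  then have ev: "even k" using hs(2) u(5) n by presburger
  consider "k = n" | "k \<le> sum_list hs" | "k \<noteq> n" "sum_list hs < k" by linarith
  then show "CM n k"
  proof cases
    case 2
    then have "spec hs k" using hs ev by (simp add: fullspec_def)
    then show ?thesis using spec_CM[OF fr(1) fr(2)[symmetric], of k] spec_append[of hs k u 0] u(1) n by simp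
  next
    case 3
    \<comment> \<open>By parity, the largest value left is \<open>n - 2\<close>, which
      \<open>u - 2\<close> couples in the last hole bring within reach.\<close>
    then have "k \<le> n - 2" using k ev n u(5) hs(2) by presburger
    then have "spec hs (k - (u - 2))" using hs ev u 3 n by (simp add: fullspec_def)
    then show ?thesis using spec_CM[OF fr(1) fr(2)[symmetric], of k] spec_append[of hs "k - (u - 2)" u "u - 2"] u n 3 by simp
  qed (use top in simp)
qed

section \<open>Starters and small tournaments\<close>

text \<open>The starters and game lists below were found by a computer search.\<close>

lemma Fr_1_3_1: "Fr (replicate 3 1 @ [1])"
  by (rule Fr_cyclic[of 1 3 1 "
    [(0,1,2,3), (0,2,3,1)]"]) code_simp+

lemma Fr_1_5_0: "Fr (replicate 5 1 @ [0])"
  by (rule Fr_cyclic[of 1 5 0 "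
    [(0,1,3,2), (0,2,1,4)]"]) code_simp+

lemma Fr_1_7_0: "Fr (replicate 7 1 @ [0])"
  by (rule Fr_cyclic[of 1 7 0 "
    [(0,1,4,3), (0,2,1,6), (0,3,5,2)]"]) code_simp+

lemma Fr_1_7_1: "Fr (replicate 7 1 @ [1])"
  by (rule Fr_cyclic[of 1 7 1 "
    [(0,1,7,3), (0,2,1,5), (0,3,4,2), (0,6,2,7)]"]) code_simp+

lemma Fr_1_9_1: "Fr (replicate 9 1 @ [1])"
  by (rule Fr_cyclic[of 1 9 1 "
    [(0,1,4,7), (0,2,9,3), (0,4,2,8), (0,5,1,9), (0,7,6,5)]"]) code_simp+

lemma Fr_1_11_0: "Fr (replicate 11 1 @ [0])"
  by (rule Fr_cyclic[of 1 11 0 "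
    [(0,1,9,8), (0,2,7,5), (0,3,5,2), (0,4,3,10), (0,5,1,7)]"]) code_simp+

lemma Fr_1_11_1: "Fr (replicate 11 1 @ [1])"
  by (rule Fr_cyclic[of 1 11 1 "
    [(0,1,11,4), (0,2,4,7), (0,4,5,3), (0,5,3,11), (0,6,1,8), (0,8,2,1)]"]) code_simp+

lemma Fr_1_11_4: "Fr (replicate 11 1 @ [4])"
  by (rule Fr_cyclic[of 1 11 4 "
    [(0,1,7,4), (0,2,11,1), (0,3,12,8), (0,4,2,13), (0,5,6,14), (0,6,8,11), (0,7,1,12), (0,9,14,7),
    (0,10,13,3)]"]) code_simp+

lemma Fr_1_13_0: "Fr (replicate 13 1 @ [0])"
  by (rule Fr_cyclic[of 1 13 0 "
    [(0,1,11,9), (0,2,4,8), (0,3,12,5), (0,5,6,1), (0,7,10,6), (0,10,8,7)]"]) code_simp+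

lemma Fr_1_13_1: "Fr (replicate 13 1 @ [1])"
  by (rule Fr_cyclic[of 1 13 1 "
    [(0,1,8,4), (0,2,7,11), (0,3,2,10), (0,5,9,3), (0,6,1,13), (0,10,3,2), (0,11,13,12)]"]) code_simp+

lemma Fr_1_15_1: "Fr (replicate 15 1 @ [1])"
  by (rule Fr_cyclic[of 1 15 1 "
    [(0,1,8,12), (0,2,4,11), (0,3,12,15), (0,5,6,4), (0,6,15,3), (0,8,1,10), (0,10,5,2), (0,11,2,1)]"]) code_simp+

lemma Fr_1_17_5: "Fr (replicate 17 1 @ [5])"
  by (rule Fr_cyclic[of 1 17 5 "
    [(0,1,19,3), (0,2,14,6), (0,3,10,19), (0,4,2,16), (0,5,11,20), (0,6,17,14), (0,7,9,21),
    (0,8,4,17), (0,10,18,9), (0,11,16,18), (0,12,5,1), (0,15,20,8), (0,16,21,13)]"]) code_simp+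

lemma Fr_1_19_7: "Fr (replicate 19 1 @ [7])"
  by (rule Fr_cyclic[of 1 19 7 "
    [(0,1,24,11), (0,2,23,1), (0,3,16,9), (0,4,2,12), (0,5,14,23), (0,6,11,24), (0,7,10,25),
    (0,8,19,5), (0,9,20,7), (0,11,13,19), (0,13,21,18), (0,14,18,20), (0,15,22,8), (0,16,12,22),
    (0,17,25,13), (0,18,15,21)]"]) code_simp+

text \<open>This frame, \<open>Fr_1_31_7\<close> and \<open>Fr_1_37_9\<close> provide
  \<open>k = n\<close> for the orders 34, 38 and 46, which a hole of size 2 or 6 rules out in the
  decompositions used for the other k.\<close>

lemma Fr_1_27_7: "Fr (replicate 27 1 @ [7])"
  by (rule Fr_cyclic[of 1 27 7 "
    [(0,1,2,5), (0,2,31,19), (0,4,20,31), (0,5,11,20), (0,6,9,29), (0,7,26,10), (0,8,19,13),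
    (0,10,15,27), (0,12,24,32), (0,13,22,30), (0,14,10,1), (0,15,6,23), (0,16,29,7), (0,19,30,17),
    (0,20,27,14), (0,22,33,6), (0,23,32,3), (0,24,28,25), (0,25,23,33), (0,26,14,28)]"]) code_simp+

lemma Fr_1_31_7: "Fr (replicate 31 1 @ [7])"
  by (rule Fr_cyclic[of 1 31 7 "
    [(0,1,7,10), (0,2,33,22), (0,4,35,17), (0,5,8,2), (0,6,21,36), (0,7,20,15), (0,8,30,13),
    (0,9,19,33), (0,10,15,37), (0,11,34,12), (0,12,9,29), (0,13,5,31), (0,15,4,27), (0,16,2,20),
    (0,17,25,24), (0,19,18,34), (0,21,31,5), (0,22,3,35), (0,24,17,32), (0,27,32,6), (0,28,36,30),
    (0,29,37,4)]"]) code_simp+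

lemma Fr_1_37_9: "Fr (replicate 37 1 @ [9])"
  by (rule Fr_cyclic[of 1 37 9 "
    [(0,1,35,37), (0,2,27,21), (0,3,32,42), (0,4,18,41), (0,5,29,26), (0,6,4,29), (0,7,6,19),
    (0,8,30,14), (0,9,43,11), (0,10,17,38), (0,11,42,22), (0,12,45,27), (0,14,26,9), (0,15,36,28),
    (0,16,44,36), (0,17,38,24), (0,18,21,43), (0,19,14,10), (0,22,39,18), (0,23,3,31),
    (0,24,28,45), (0,26,22,39), (0,27,41,17), (0,30,24,40), (0,32,25,44), (0,35,37,32),
    (0,36,40,35)]"]) code_simp+

lemma Fr_2_3_2: "Fr (replicate 3 2 @ [2])"
  by (rule Fr_cyclic[of 2 3 2 "
    [(0,1,6,2), (0,2,4,7), (0,4,5,6), (0,5,7,1)]"]) code_simp+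

lemma Fr_2_4_1: "Fr (replicate 4 2 @ [1])"
  by (rule Fr_cyclic[of 2 4 1 "
    [(0,1,7,6), (0,2,5,3), (0,3,8,1), (0,5,6,8)]"]) code_simp+

lemma Fr_2_4_3: "Fr (replicate 4 2 @ [3])"
  by (rule Fr_cyclic[of 2 4 3 "
    [(0,1,7,8), (0,2,8,1), (0,3,5,10), (0,5,10,7), (0,6,9,3), (0,7,2,9)]"]) code_simp+

lemma Fr_2_5_0: "Fr (replicate 5 2 @ [0])"
  by (rule Fr_cyclic[of 2 5 0 "
    [(0,1,2,8), (0,2,9,6), (0,3,6,4), (0,4,3,2)]"]) code_simp+

lemma Fr_2_5_3: "Fr (replicate 5 2 @ [3])"
  by (rule Fr_cyclic[of 2 5 3 "
    [(0,1,9,8), (0,2,10,4), (0,3,6,12), (0,4,11,3), (0,6,7,10), (0,7,12,1), (0,8,2,11)]"]) code_simp+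

lemma Fr_2_5_4: "Fr (replicate 5 2 @ [4])"
  by (rule Fr_cyclic[of 2 5 4 "
    [(0,1,9,10), (0,2,11,4), (0,3,6,13), (0,4,3,11), (0,6,8,12), (0,7,10,3), (0,8,13,9), (0,9,12,6)]"]) code_simp+

lemma Fr_2_6_0: "Fr (replicate 6 2 @ [0])"
  by (rule Fr_cyclic[of 2 6 0 "
    [(0,1,10,5), (0,2,4,9), (0,3,7,4), (0,4,3,2), (0,8,1,11)]"]) code_simp+

lemma Fr_2_6_1: "Fr (replicate 6 2 @ [1])"
  by (rule Fr_cyclic[of 2 6 1 "
    [(0,1,11,4), (0,2,4,3), (0,3,7,11), (0,7,10,12), (0,8,3,1), (0,9,12,7)]"]) code_simp+

lemma Fr_2_6_3: "Fr (replicate 6 2 @ [3])"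
  by (rule Fr_cyclic[of 2 6 3 "
    [(0,1,3,2), (0,2,7,14), (0,3,11,12), (0,4,12,11), (0,5,8,3), (0,8,13,5), (0,9,14,1),
    (0,10,2,13)]"]) code_simp+

lemma Fr_2_7_0: "Fr (replicate 7 2 @ [0])"
  by (rule Fr_cyclic[of 2 7 0 "
    [(0,1,12,10), (0,2,5,8), (0,4,3,2), (0,5,1,9), (0,6,8,5), (0,9,10,6)]"]) code_simp+

lemma Fr_2_7_1: "Fr (replicate 7 2 @ [1])"
  by (rule Fr_cyclic[of 2 7 1 "
    [(0,1,5,9), (0,2,10,13), (0,5,2,14), (0,6,1,11), (0,8,6,4), (0,9,11,8), (0,13,14,1)]"]) code_simp+

lemma Fr_2_8_0: "Fr (replicate 8 2 @ [0])"
  by (rule Fr_cyclic[of 2 8 0 "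
    [(0,1,3,13), (0,2,1,12), (0,3,14,4), (0,4,10,15), (0,7,12,9), (0,9,7,6), (0,12,5,3)]"]) code_simp+

text \<open>Meant for order 45 with at most 7 couples, all of them in the last hole;
  \<open>Fr_2_19_8\<close> does the same for order 46 with at most 8 couples.\<close>

lemma Fr_2_19_7: "Fr (replicate 19 2 @ [7])"
  by (rule Fr_cyclic[of 2 19 7 "
    [(0,1,34,13), (0,2,22,30), (0,3,18,38), (0,4,40,10), (0,5,14,25), (0,6,44,4), (0,7,5,41),
    (0,9,31,6), (0,10,28,17), (0,12,26,8), (0,14,15,36), (0,15,38,28), (0,16,1,33), (0,18,11,9),
    (0,22,25,39), (0,23,41,12), (0,24,3,44), (0,25,32,42), (0,26,42,3), (0,28,17,14), (0,29,2,40),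
    (0,30,29,22), (0,33,43,34), (0,34,8,43), (0,37,39,32)]"]) code_simp+

lemma Fr_2_19_8: "Fr (replicate 19 2 @ [8])"
  by (rule Fr_cyclic[of 2 19 8 "
    [(0,1,36,41), (0,2,6,42), (0,3,43,20), (0,4,39,33), (0,5,25,17), (0,6,18,31), (0,7,17,43),
    (0,8,44,14), (0,9,7,36), (0,10,4,38), (0,11,41,9), (0,12,26,39), (0,14,1,21), (0,15,16,11),
    (0,16,9,30), (0,17,5,27), (0,18,24,45), (0,23,8,5), (0,24,27,23), (0,25,15,40), (0,26,10,4),
    (0,27,38,22), (0,28,42,25), (0,31,40,8), (0,36,35,44), (0,37,45,29)]"]) code_simp+

lemma Fr_4_4_6: "Fr (replicate 4 4 @ [6])"
  by (rule Fr_cyclic[of 4 4 6 "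
    [(0,1,16,3), (0,2,20,1), (0,3,18,10), (0,5,6,20), (0,6,11,16), (0,7,9,21), (0,9,3,17),
    (0,10,19,5), (0,11,2,19), (0,13,17,7), (0,14,1,18), (0,15,21,2)]"]) code_simp+

lemma Fr_4_5_6: "Fr (replicate 5 4 @ [6])"
  by (rule Fr_cyclic[of 4 5 6 "
    [(0,1,17,13), (0,2,22,11), (0,3,9,22), (0,4,12,23), (0,6,19,24), (0,7,20,8), (0,8,23,6),
    (0,9,21,2), (0,11,14,20), (0,12,13,21), (0,13,25,9), (0,14,16,25), (0,17,24,3), (0,18,2,1)]"]) code_simp+

lemma Fr_4_7_7: "Fr (replicate 7 4 @ [7])"
  by (rule Fr_cyclic[of 4 7 7 "
    [(0,1,11,16), (0,2,27,33), (0,3,28,25), (0,4,29,20), (0,6,5,32), (0,8,25,19), (0,9,13,5),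
    (0,10,12,2), (0,11,22,6), (0,13,9,29), (0,15,34,12), (0,16,33,15), (0,17,8,34), (0,19,30,10),
    (0,23,32,13), (0,24,31,22), (0,25,26,28), (0,26,18,30), (0,27,4,31)]"]) code_simp+

lemma Fr_2_5_1: "Fr (replicate 5 2 @ [1])"
  by (rule Fr_explicit[of 5 1 "
    [(0,2,6,8), (0,3,8,10), (0,4,9,6), (0,5,7,2), (0,6,4,9), (0,7,2,5), (0,8,10,7), (0,9,5,3),
    (0,10,3,4), (1,5,10,9), (1,6,5,10), (1,7,9,3), (1,8,7,5), (1,9,3,7), (2,0,8,6), (2,1,4,8),
    (2,4,7,9), (2,6,10,1), (2,7,5,0), (2,8,1,4), (2,9,6,10), (2,10,9,5), (3,0,10,8), (3,5,9,0),
    (3,8,5,6), (3,9,7,1), (4,0,6,9), (4,1,8,2), (4,2,9,7), (4,3,10,0), (4,6,1,3), (4,7,3,10),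
    (4,10,7,8), (5,1,9,10), (5,2,7,0), (5,9,10,2), (6,0,9,4), (6,1,10,5), (6,2,1,10), (6,3,5,8),
    (6,4,3,1), (6,5,8,3), (7,3,9,1), (7,4,10,3), (8,0,7,10), (8,1,5,7), (8,4,1,2), (8,5,3,6),
    (8,7,10,4), (9,2,10,6)]"]) code_simp+

lemma CM_2_0: "CM 2 0"
  by (rule CM_explicit[of 2 0 "
    [(0,0,1,1), (0,1,1,0)]"]) code_simp+

lemma CM_4_0: "CM 4 0"
  by (rule CM_explicit[of 4 0 "
    [(0,0,1,3), (0,1,2,0), (0,2,1,1), (0,3,3,2), (1,0,3,1), (1,2,2,3), (2,1,3,3), (2,2,3,0)]"]) code_simp+

lemma CM_5_1: "CM 5 1"
  by (rule CM_explicit[of 5 1 "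
    [(0,1,1,3), (0,2,2,4), (0,3,3,2), (0,4,4,1), (1,0,3,4), (1,1,2,2), (1,2,4,0), (1,4,2,3),
    (2,0,4,3), (2,1,3,0), (3,1,4,2), (3,3,4,4)]"]) code_simp+

lemma CM_6_0: "CM 6 0"
  by (rule CM_explicit[of 6 0 "
    [(0,0,2,5), (0,1,1,4), (0,2,5,1), (0,3,4,2), (0,4,1,0), (0,5,3,3), (1,1,3,5), (1,2,4,3),
    (1,3,5,0), (1,5,2,2), (2,0,4,1), (2,1,5,3), (2,3,3,4), (2,4,3,2), (3,0,5,2), (3,1,4,0),
    (4,4,5,5), (4,5,5,4)]"]) code_simp+

lemma CM_6_4: "CM 6 4"
  by (rule CM_explicit[of 6 4 "
    [(0,1,3,2), (0,2,4,4), (0,3,5,1), (0,4,1,5), (0,5,2,3), (1,0,5,2), (1,2,3,5), (1,3,2,0),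
    (1,4,4,3), (2,1,4,0), (2,4,3,1), (2,5,5,4), (3,0,4,5), (3,4,5,0), (4,1,5,5), (4,2,5,3)]"]) code_simp+

lemma CM_7_1: "CM 7 1"
  by (rule CM_explicit[of 7 1 "
    [(0,1,1,4), (0,2,2,3), (0,3,6,5), (0,4,5,6), (0,5,3,2), (0,6,4,1), (1,0,4,3), (1,1,6,2),
    (1,2,5,0), (1,3,3,4), (1,5,2,6), (1,6,2,5), (2,0,6,1), (2,1,5,3), (2,2,4,4), (2,4,3,0),
    (3,1,4,2), (3,3,4,6), (3,5,5,1), (3,6,6,0), (4,0,5,5), (4,5,6,4), (5,2,6,6), (5,4,6,3)]"]) code_simp+

lemma CM_7_3: "CM 7 3"
  by (rule CM_explicit[of 7 3 "
    [(0,1,2,3), (0,2,6,6), (0,3,1,4), (0,4,3,2), (0,5,5,1), (0,6,4,5), (1,0,3,5), (1,2,4,0),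
    (1,3,5,2), (1,5,2,6), (1,6,6,4), (2,0,6,3), (2,1,3,6), (2,4,5,0), (2,5,4,4), (3,0,5,6),
    (3,1,4,2), (3,3,6,5), (3,4,4,3), (4,1,6,0), (4,6,5,3), (5,4,6,1), (5,5,6,2)]"]) code_simp+

lemma CM_7_5: "CM 7 5"
  by (rule CM_explicit[of 7 5 "
    [(0,1,5,3), (0,2,6,4), (0,3,2,6), (0,4,3,5), (0,5,1,2), (0,6,4,1), (1,0,3,6), (1,3,6,2),
    (1,4,5,0), (1,5,4,3), (1,6,2,4), (2,0,4,5), (2,1,6,0), (2,3,5,4), (2,5,3,1), (3,0,5,2),
    (3,2,4,6), (3,4,6,1), (4,0,6,3), (4,2,5,1), (5,5,6,6), (5,6,6,5)]"]) code_simp+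

lemma CM_8_2: "CM 8 2"
  by (rule CM_explicit[of 8 2 "
    [(0,1,4,7), (0,2,7,3), (0,3,6,6), (0,4,2,5), (0,5,5,1), (0,6,1,4), (0,7,3,2), (1,0,4,3),
    (1,2,2,0), (1,3,5,4), (1,5,6,2), (1,6,3,7), (1,7,7,5), (2,1,5,6), (2,2,4,1), (2,3,3,5),
    (2,4,3,0), (2,6,7,7), (2,7,6,3), (3,1,6,0), (3,3,7,1), (3,4,4,5), (3,6,5,2), (4,0,7,6),
    (4,2,5,3), (4,4,5,7), (4,6,6,5), (5,0,6,7), (5,5,7,0), (6,1,7,4), (6,4,7,2)]"]) code_simp+

lemma CM_8_4: "CM 8 4"
  by (rule CM_explicit[of 8 4 "
    [(0,1,5,7), (0,2,1,3), (0,3,2,4), (0,4,4,2), (0,5,6,6), (0,6,3,1), (0,7,7,5), (1,0,3,7),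
    (1,2,7,6), (1,4,5,5), (1,5,4,4), (1,6,2,0), (1,7,6,3), (2,1,4,0), (2,3,6,5), (2,5,5,1),
    (2,6,7,7), (2,7,3,4), (3,0,4,5), (3,2,6,1), (3,5,7,2), (3,6,5,4), (4,1,7,3), (4,3,5,6),
    (4,6,6,7), (4,7,5,2), (5,0,6,2), (5,3,7,0), (6,0,7,4), (6,4,7,1)]"]) code_simp+

lemma CM_8_6: "CM 8 6"
  by (rule CM_explicit[of 8 6 "
    [(0,1,2,5), (0,2,5,3), (0,3,4,7), (0,4,7,1), (0,5,1,4), (0,6,6,2), (0,7,3,6), (1,0,3,4),
    (1,2,6,0), (1,3,7,6), (1,5,2,3), (1,6,5,7), (1,7,4,2), (2,0,4,3), (2,1,3,7), (2,4,5,6),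
    (2,6,7,0), (2,7,6,4), (3,0,6,5), (3,1,5,2), (3,2,7,4), (3,5,4,6), (4,0,5,1), (4,1,6,6),
    (4,5,7,2), (5,0,7,7), (5,4,6,3), (6,1,7,3), (6,7,7,5)]"]) code_simp+

lemma CM_9_9: "CM 9 9"
  by (rule CM_explicit[of 9 9 "
    [(0,1,4,5), (0,2,8,4), (0,3,6,8), (0,4,1,7), (0,5,3,6), (0,6,2,3), (0,7,5,2), (0,8,7,1),
    (1,0,6,5), (1,2,5,3), (1,3,4,7), (1,4,7,6), (1,5,2,8), (1,6,8,2), (1,8,3,0), (2,0,3,4),
    (2,1,7,3), (2,4,5,8), (2,5,8,7), (2,6,4,1), (2,7,6,0), (3,1,5,7), (3,2,6,1), (3,5,7,4),
    (3,7,8,6), (3,8,4,2), (4,0,7,2), (4,3,8,5), (4,6,5,0), (4,8,6,7), (5,1,8,0), (5,4,6,3),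
    (5,6,7,8), (6,2,7,5), (6,4,8,1), (7,0,8,3)]"]) code_simp+

lemma CM_10_8: "CM 10 8"
  by (rule CM_explicit[of 10 8 "
    [(0,1,7,4), (0,2,5,9), (0,3,2,8), (0,4,9,6), (0,5,1,2), (0,6,8,7), (0,7,4,3), (0,8,6,1),
    (0,9,3,5), (1,0,5,4), (1,3,6,9), (1,4,3,8), (1,5,9,7), (1,6,2,3), (1,7,8,0), (1,8,7,2),
    (1,9,4,6), (2,0,8,1), (2,1,6,5), (2,4,7,9), (2,5,4,8), (2,6,9,0), (2,7,3,4), (2,9,5,7),
    (3,0,4,5), (3,1,8,2), (3,2,7,6), (3,6,5,8), (3,7,9,1), (3,9,6,0), (4,0,9,2), (4,1,5,6),
    (4,2,8,3), (4,7,6,8), (4,9,7,1), (5,0,7,8), (5,1,9,3), (5,2,6,7), (5,3,8,4), (6,2,9,4),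
    (6,3,7,0), (6,4,8,5), (7,3,9,5), (7,5,8,6), (8,8,9,9), (8,9,9,8)]"]) code_simp+

section \<open>Sums over the holes\<close>

lemma Fr_pairs: "s \<in> {4, 5, 6} \<Longrightarrow> j \<le> 3 \<Longrightarrow> Fr (replicate s 2 @ [j])"
proof -
  \<comment> \<open>A last hole of size 2 is one more hole of the common size, so these cases are
    frames already found under other parameters.\<close>
  have z: "Fr (replicate 4 2 @ [0])" "Fr (replicate 4 2 @ [2])" "Fr (replicate 5 2 @ [2])" "Fr (replicate 6 2 @ [2])"
    using Fr_2_3_2 Fr_2_5_0 Fr_2_6_0 Fr_2_7_0 Fr_append_0[of "replicate 4 2"] Fr_append_0[of "replicate 5 2"]
      Fr_append_0[of "replicate 6 2"] Fr_append_0[of "replicate 7 2"]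
    by (simp_all add: numeral_eq_Suc)
  assume "s \<in> {4, 5, 6}" "j \<le> 3"
  moreover from this have "j \<in> {0, 1, 2, 3}" by auto
  ultimately show ?thesis
    using z Fr_2_4_1 Fr_2_4_3 Fr_2_5_0 Fr_2_5_1 Fr_2_5_3 Fr_2_6_0 Fr_2_6_1 Fr_2_6_3 by blast
qed

lemmas Fr_master = Fr_truncated_TD[OF Fr_pairs]

section \<open>Small tournaments obtained by filling small frames\<close>

lemma CM_sols: "Fr (replicate t 1 @ [u]) \<Longrightarrow> CM u u \<Longrightarrow> CM (t + u) (t + u)"
  using Fr_fill_replicate[of t 1 u 1 1 u t] CM_1_1 by simp

text \<open>With \<open>CM 2 0\<close> in every hole of size 2, only the last hole contributes
  couples. This supplies most lower values for \<open>ends\<close>; \<open>CM_sols\<close>, with one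
  couple in each hole of size 1, supplies most upper ones.\<close>

lemma CM_pairs: "Fr (replicate t 2 @ [u]) \<Longrightarrow> CM u k \<Longrightarrow> CM (2 * t + u) k"
  using Fr_fill_replicate[of t 2 u 0 0 k t] CM_2_0 by (simp add: mult.commute)

lemma CM_4_4: "CM 4 4" using CM_sols[OF Fr_1_3_1 CM_1_1] by simp
lemma CM_5_5: "CM 5 5" using CM_sols[OF Fr_1_5_0 CM_0_0] by simp
lemma CM_7_7: "CM 7 7" using CM_sols[OF Fr_1_7_0 CM_0_0] by simp
lemma CM_8_0: "CM 8 0" using CM_pairs[OF Fr_2_3_2 CM_2_0] by simp
lemma CM_8_8: "CM 8 8" using CM_sols[OF Fr_1_7_1 CM_1_1] by simp
lemma CM_10_0: "CM 10 0" using CM_pairs[OF Fr_2_5_0 CM_0_0] by simp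
lemma CM_10_10: "CM 10 10" using CM_sols[OF Fr_1_9_1 CM_1_1] by simp
lemma CM_14_0: "CM 14 0" using CM_pairs[OF Fr_2_7_0 CM_0_0] by simp
lemma CM_14_4: "CM 14 4" using CM_pairs[OF Fr_2_5_4 CM_4_4] by simp
lemma CM_14_14: "CM 14 14" using CM_sols[OF Fr_1_13_1 CM_1_1] by simp
lemma CM_22_22: "CM 22 22" using CM_sols[OF Fr_1_17_5 CM_5_5] by simp
lemma CM_26_26: "CM 26 26" using CM_sols[OF Fr_1_19_7 CM_7_7] by simp

lemma CM_fours:
  assumes "Fr (replicate t 4 @ [u])" "CM u c" "j \<le> t"
  shows "CM (4 * t + u) (4 * j + c)"
  using Fr_fill_replicate[OF assms(1) CM_4_4 CM_4_0 assms(2,3)] by (simp add: mult.commute)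

text \<open>22 = 4 * 4 + 6, where each hole of size 4 takes 0 or 4 couples. The hole of size 6 takes
  none, except for \<open>b = 5\<close>, where it takes 4.\<close>

lemma CM_22_mult4: "b \<le> 5 \<Longrightarrow> CM 22 (4 * b)"
  using CM_fours[OF Fr_4_4_6 CM_6_0, of b] CM_fours[OF Fr_4_4_6 CM_6_4, of "b - 1"]
  by (cases "b \<le> 4") (auto simp: diff_mult_distrib2)

lemma CM_26_mult4: "b \<le> 6 \<Longrightarrow> CM 26 (4 * b)"
  using CM_fours[OF Fr_4_5_6 CM_6_0, of b] CM_fours[OF Fr_4_5_6 CM_6_4, of "b - 1"]
  by (cases "b \<le> 5") (auto simp: diff_mult_distrib2)

lemma CM_7: "e \<in> {1, 3, 5, 7} \<Longrightarrow> CM 7 e"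
  using CM_7_1 CM_7_3 CM_7_5 CM_7_7 by auto

lemma CM_8: "e \<in> {0, 2, 4, 6, 8} \<Longrightarrow> CM 8 e"
  using CM_8_0 CM_8_2 CM_8_4 CM_8_6 CM_8_8 by auto

lemma full_8: "full 8"
proof -
  have "k \<in> {0, 2, 4, 6, 8}" if "k \<le> 8" "even (8 - k)" for k :: nat
    using that by (unfold insert_iff empty_iff, presburger+)
  then show ?thesis unfolding full_def using CM_8 by blast
qed

text \<open>The sizes 2, 3 and 6 are left out because their upper value fails, there being no
  self-orthogonal Latin square of these orders.\<close>

lemma ends_small: "u \<in> {0, 1, 4, 5} \<or> 7 \<le> u \<and> u \<le> 16 \<Longrightarrow> ends u"
proof -
  have "ends 0" "ends 1" "ends 4" "ends 5" "ends 7" "ends 8"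
    using CM_0_0 CM_1_1 CM_4_0 CM_4_4 CM_5_1 CM_5_5 CM_7_1 CM_7_7 CM_8_0 CM_8_8 by (simp_all add: ends_def)
  moreover have "ends 9" using CM_pairs[OF Fr_2_4_1 CM_1_1] CM_9_9 by (simp add: ends_def)
  moreover have "ends 10" using CM_10_0 CM_10_10 by (simp add: ends_def)
  moreover have "ends 11" using CM_pairs[OF Fr_2_5_1 CM_1_1] CM_sols[OF Fr_1_11_0 CM_0_0] by (simp add: ends_def)
  moreover have "ends 12" using CM_pairs[OF Fr_2_6_0 CM_0_0] CM_sols[OF Fr_1_11_1 CM_1_1] by (simp add: ends_def)
  moreover have "ends 13" using CM_pairs[OF Fr_2_6_1 CM_1_1] CM_sols[OF Fr_1_13_0 CM_0_0] by (simp add: ends_def)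
  moreover have "ends 14" using CM_14_0 CM_14_14 by (simp add: ends_def)
  moreover have "ends 15" using CM_pairs[OF Fr_2_7_1 CM_1_1] CM_sols[OF Fr_1_11_4 CM_4_4] by (simp add: ends_def)
  moreover have "ends 16" using CM_pairs[OF Fr_2_8_0 CM_0_0] CM_sols[OF Fr_1_15_1 CM_1_1] by (simp add: ends_def)
  moreover assume "u \<in> {0, 1, 4, 5} \<or> 7 \<le> u \<and> u \<le> 16"
  then have "u \<in> {0, 1, 4, 5, 7, 8, 9, 10, 11, 12, 13, 14, 15, 16}"
    unfolding insert_iff empty_iff by presburger
  ultimately show ?thesis by blast
qed

section \<open>Four equal holes of size 10, 14, 22 or 26\<close>

lemma spec_quad:
  assumes "CM h k1" "CM h k2" "CM h k3" "CM h k4" "spec hs y" "x = k1 + k2 + k3 + k4 + y"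
  shows "spec (replicate 4 h @ hs) x"
  using assms spec_Cons[OF assms(1) spec_Cons[OF assms(2) spec_Cons[OF assms(3) spec_Cons[OF assms(4,5)]]]]
  by (simp add: numeral_eq_Suc add.assoc)

lemma spec_single: "CM h k \<Longrightarrow> spec [h] k"
  using spec_append[OF spec_Nil] by simp

text \<open>Division with remainder by \<open>h\<close>: \<open>a\<close> holes carry
  \<open>h\<close> couples, one carries \<open>b\<close>, the others none. For a given list of holes
  it remains to write the residue of \<open>x\<close> modulo \<open>h\<close> as
  \<open>b + y\<close>.\<close>

lemma spec_quad_tops:
  assumes h: "CM h 0" "CM h h" "CM h b" and y: "spec hs y" and a: "a \<le> 3 \<or> a = 4 \<and> b = 0" and x: "x = h * a + b + y"
  shows "spec (replicate 4 h @ hs) x"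
proof -
  let ?k = "\<lambda>i. if i < a then h else 0"
  have k: "CM h (?k i)" for i :: nat using h by simp
  have b: "CM h (if a = 4 then h else b)" using h by simp
  have "a \<in> {0, 1, 2, 3, 4}" using a by auto
  then have "x = ?k 0 + ?k 1 + ?k 2 + (if a = 4 then h else b) + y"
    using a x by (auto simp: numeral_eq_Suc)
  then show ?thesis using spec_quad[OF k[of 0] k[of 1] k[of 2] b y] by blast
qed

lemma fullspec_10_8: "fullspec (replicate 4 10 @ [8])"
  unfolding fullspec_def
proof (intro allI impI)
  fix x :: nat assume "x \<le> sum_list (replicate 4 10 @ [8])" "even (sum_list (replicate 4 10 @ [8]) - x)"
  then have "x \<le> 48" "even (48 - x)" by (simp_all add: sum_list_replicate)
  then have x: "x \<le> 48" "even x" by presburger+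
  then have "x mod 10 \<in> {0, 2, 4, 6, 8}" "x div 10 \<le> 4" by (unfold insert_iff empty_iff, presburger+)
  then show "spec (replicate 4 10 @ [8]) x"
    by (intro spec_quad_tops[OF CM_10_0 CM_10_10 CM_10_0 spec_single[OF CM_8], of "x mod 10" "x div 10"]) auto
qed

text \<open>Residues modulo 14 up to 8 come from the hole of size 8; for 10 and 12 one large hole
  takes 4 couples, leaving 6 or 8.\<close>

lemma fullspec_14_8: "fullspec (replicate 4 14 @ [8])"
  unfolding fullspec_def
proof (intro allI impI)
  fix x :: nat assume "x \<le> sum_list (replicate 4 14 @ [8])" "even (sum_list (replicate 4 14 @ [8]) - x)"
  then have "x \<le> 64" "even (64 - x)" by (simp_all add: sum_list_replicate)
  then have x: "x \<le> 64" "even x" by presburger+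
  show "spec (replicate 4 14 @ [8]) x"
  proof (cases "x mod 14 \<le> 8")
    case True
    then have "x mod 14 \<in> {0, 2, 4, 6, 8}" "x div 14 \<le> 4" using x by (unfold insert_iff empty_iff, presburger+)
    then show ?thesis
      by (intro spec_quad_tops[OF CM_14_0 CM_14_14 CM_14_0 spec_single[OF CM_8], of "x mod 14" "x div 14"]) auto
  next
    case False
    then have "x mod 14 - 4 \<in> {6, 8}" "x div 14 \<le> 3" using x by (unfold insert_iff empty_iff, presburger+)
    moreover have "x = 14 * (x div 14) + 4 + (x mod 14 - 4)" using False by simp
    ultimately show ?thesis
      by (intro spec_quad_tops[OF CM_14_0 CM_14_14 CM_14_4 spec_single[OF CM_8], of "x mod 14 - 4" "x div 14"]) auto
  qed
qed

text \<open>The residue of \<open>x\<close> modulo \<open>h\<close> splits into a multiple of 4, put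
  into one large hole, and at most 3 couples for the hole \<open>w\<close>, which is where
  \<open>3 \<le> w\<close> enters.\<close>

lemma fullspec_mult4:
  assumes h: "CM h h" "\<And>b. 4 * b < h \<Longrightarrow> CM h (4 * b)" "even h" "0 < h"
    and w: "full w" "3 \<le> w"
  shows "fullspec (replicate 4 h @ [w])"
  unfolding fullspec_def
proof (intro allI impI)
  fix x :: nat assume "x \<le> sum_list (replicate 4 h @ [w])" "even (sum_list (replicate 4 h @ [w]) - x)"
  then have x: "x \<le> 4 * h + w" "even (4 * h + w - x)" by (simp_all add: sum_list_replicate)
  then have xw: "even x = even w" by presburger
  have cw: "CM w e" if "e \<le> w" "even e = even w" for e
    using w(1) that by (simp add: full_def)
  have h0: "CM h 0" using h(2)[of 0] h(4) by simp
  show "spec (replicate 4 h @ [w]) x"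
  proof (cases "4 * h \<le> x")
    case True
    then have "CM w (x - 4 * h)" using x(1) xw by (intro cw) auto
    then show ?thesis
      using True by (intro spec_quad_tops[OF h0 h(1) h0 spec_single, of w "x - 4 * h" 4]) simp_all
  next
    case False
    let ?r = "x mod h"
    have "even ?r = even x" using h(3) by (simp add: dvd_mod_iff)
    then have "even (?r mod 4) = even w" using xw by (simp add: dvd_mod_iff)
    moreover have "?r mod 4 \<le> 3" using mod_less_divisor[of 4 ?r] by linarith
    ultimately have "CM w (?r mod 4)" using w(2) by (intro cw) linarith+
    moreover have "4 * (?r div 4) \<le> ?r" by simp
    then have "CM h (4 * (?r div 4))" using h(4) by (intro h(2)) (meson le_less_trans mod_less_divisor)
    moreover have "x div h \<le> 3"
    proof -
      have "x div h < 4" using False h(4) by (simp add: div_less_iff_less_mult)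
      then show ?thesis by simp
    qed
    ultimately show ?thesis
      by (intro spec_quad_tops[OF h0 h(1) _ spec_single, of "4 * (?r div 4)" w "?r mod 4" "x div h"]) simp_all
  qed
qed

lemma full_7: "full 7"
proof -
  have "k \<in> {1, 3, 5, 7}" if "k \<le> 7" "even (7 - k)" for k :: nat
    using that by (unfold insert_iff empty_iff, presburger+)
  then show ?thesis unfolding full_def using CM_7 by blast
qed

lemma fullspec_22: "full w \<Longrightarrow> 3 \<le> w \<Longrightarrow> fullspec (replicate 4 22 @ [w])"
  by (rule fullspec_mult4) (use CM_22_22 CM_22_mult4 in auto)

lemma fullspec_26: "full w \<Longrightarrow> 3 \<le> w \<Longrightarrow> fullspec (replicate 4 26 @ [w])"
  by (rule fullspec_mult4) (use CM_26_26 CM_26_mult4 in auto)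

text \<open>Residue 9 modulo 10 exceeds 7 and is written as 8 + 1, with 8 couples in one large
  hole.\<close>

lemma fullspec_10_7: "fullspec (replicate 4 10 @ [7])"
  unfolding fullspec_def
proof (intro allI impI)
  fix x :: nat assume "x \<le> sum_list (replicate 4 10 @ [7])" "even (sum_list (replicate 4 10 @ [7]) - x)"
  then have "x \<le> 47" "even (47 - x)" by (simp_all add: sum_list_replicate)
  then have x: "x \<le> 47" "odd x" by presburger+
  show "spec (replicate 4 10 @ [7]) x"
  proof (cases "x mod 10 \<le> 7")
    case True
    then have "x mod 10 \<in> {1, 3, 5, 7}" "x div 10 \<le> 4" using x by (unfold insert_iff empty_iff, presburger+)
    then show ?thesis
      by (intro spec_quad_tops[OF CM_10_0 CM_10_10 CM_10_0 spec_single[OF CM_7], of "x mod 10" "x div 10"]) auto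
  next
    case False
    then have "x mod 10 - 8 \<in> {1, 3}" "x div 10 \<le> 3" using x by (unfold insert_iff empty_iff, presburger+)
    moreover have "x = 10 * (x div 10) + 8 + (x mod 10 - 8)" using False by simp
    ultimately show ?thesis
      by (intro spec_quad_tops[OF CM_10_0 CM_10_10 CM_10_8 spec_single[OF CM_7], of "x mod 10 - 8" "x div 10"]) auto
  qed
qed

text \<open>The list is made for order 67. Residues 9 and 11 modulo 14 fill the hole of size 4
  completely; residue 13 is 4 + 4 + 5, with 4 couples in one large hole.\<close>

lemma fullspec_14_4_7: "fullspec (replicate 4 14 @ [4, 7])"
  unfolding fullspec_def
proof (intro allI impI)
  fix x :: nat assume "x \<le> sum_list (replicate 4 14 @ [4, 7])" "even (sum_list (replicate 4 14 @ [4, 7]) - x)"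
  then have "x \<le> 67" "even (67 - x)" by (simp_all add: sum_list_replicate)
  then have x: "x \<le> 67" "odd x" by presburger+
  have y: "spec [4, 7] e" "spec [4, 7] (4 + e)" if "e \<in> {1, 3, 5, 7}" for e
    using spec_Cons[OF CM_4_0 spec_single[OF CM_7[OF that]]] spec_Cons[OF CM_4_4 spec_single[OF CM_7[OF that]]] by simp_all
  consider "x mod 14 \<le> 7" | "x mod 14 \<in> {9, 11}" | "x mod 14 = 13" using x by (unfold insert_iff empty_iff, atomize_elim, presburger)
  then show "spec (replicate 4 14 @ [4, 7]) x"
  proof cases
    case 1
    then have "x mod 14 \<in> {1, 3, 5, 7}" "x div 14 \<le> 4" using x by (unfold insert_iff empty_iff, presburger+)
    then show ?thesis
      by (intro spec_quad_tops[OF CM_14_0 CM_14_14 CM_14_0 y(1), of "x mod 14" "x div 14"]) auto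
  next
    case 2
    then have "x mod 14 - 4 \<in> {5, 7}" "x div 14 \<le> 4"
      using x unfolding insert_iff empty_iff by presburger+
    moreover have "x = 14 * (x div 14) + (4 + (x mod 14 - 4))" using 2 unfolding insert_iff empty_iff by presburger
    ultimately show ?thesis
      by (intro spec_quad_tops[OF CM_14_0 CM_14_14 CM_14_0 y(2), of "x mod 14 - 4" "x div 14"]) auto
  next
    case 3
    then have "x div 14 \<le> 3" "x = 14 * (x div 14) + 4 + (4 + 5)" using x by presburger+
    then show ?thesis
      by (intro spec_quad_tops[OF CM_14_0 CM_14_14 CM_14_4 y(2), of 5 "x div 14"]) auto
  qed
qed


section \<open>The transversal designs in use\<close>

lemma TD_coprime_6:
  assumes "coprime m 6" "m > 0"
  shows "TD 5 m" "TD 6 m"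
proof -
  have "coprime m 2" "coprime m 3" using assms(1) by (auto intro: coprime_divisors[of _ m _ 6])
  moreover from this have "coprime m (2 * 2)" by (simp only: coprime_mult_right_iff)
  ultimately have "coprime 1 m" "coprime 2 m" "coprime 3 m" "coprime 4 m"
    by (simp_all add: coprime_commute)
  \<comment> \<open>Slopes 0 to 4 have differences at most 4, whose prime factors are 2 and
    3.\<close>
  then have c: "coprime d m" if "1 \<le> d" "d \<le> 4" for d
    using that by (cases "d = 1 \<or> d = 2 \<or> d = 3") (auto simp: le_Suc_eq numeral_eq_Suc)
  show "TD 5 m" "TD 6 m" using TD_linear[of 3 m] TD_linear[of 4 m] c assms(2) by simp_all
qed

text \<open>The seventh group needs slope 5, so 5 has to be invertible as well.\<close>

lemma TD_7: "m \<in> {7, 11, 13} \<Longrightarrow> TD 7 m"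
proof -
  assume "m \<in> {7, 11, 13}"
  then have "TD (5 + 2) m"
  proof (intro TD_linear)
    fix d :: nat assume "1 \<le> d" "d \<le> 5"
    then have "d \<in> {1, 2, 3, 4, 5}" by (unfold insert_iff empty_iff, presburger)
    with \<open>m \<in> {7, 11, 13}\<close> show "coprime d m" by (auto simp: coprime_iff_gcd_eq_1 gcd_nat.simps[of _ "numeral _"])
  qed auto
  then show ?thesis by simp
qed


text \<open>The rows of the table are the columns of the orthogonal array, listed along the index
  \<open>x * m + y\<close>. Distinctness of two zipped rows says that no pair of symbols repeats;
  counting turns this into bijectivity.\<close>

definition TD_table :: "nat \<Rightarrow> nat list list \<Rightarrow> bool" where
  "TD_table m T \<longleftrightarrow> distinct T \<and> list_all (\<lambda>r. length r = m * m \<and> list_all (\<lambda>x. x < m) r) T \<and>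
     list_all (\<lambda>r. list_all (\<lambda>s. r = s \<or> distinct (zip r s)) T) T"

lemma TD_from_table:
  assumes "TD_table m T"
  shows "TD (length T) m"
  unfolding TD_def
proof (intro exI allI impI)
  fix i j assume ij: "i < length T" "j < length T" "i \<noteq> j"
  let ?P = "{..<m} \<times> {..<m}" and ?i = "\<lambda>p. fst p * m + snd p"
  let ?f = "\<lambda>p. (T ! i ! ?i p, T ! j ! ?i p)"
  have T: "length r = m * m" "x \<in> set r \<Longrightarrow> x < m" if "r \<in> set T" for r x
    using assms that by (auto simp: TD_table_def list_all_iff)
  have "T ! i \<noteq> T ! j" using assms ij by (simp add: TD_table_def nth_eq_iff_index_eq)
  then have d: "distinct (zip (T ! i) (T ! j))"
    using assms ij unfolding TD_table_def list_all_iff by (metis nth_mem)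
  have l: "length (T ! i) = m * m" "length (T ! j) = m * m" using T ij by simp_all
  have lt: "?i p < m * m" if "p \<in> ?P" for p
  proof -
    have "?i p < Suc (fst p) * m" using that by auto
    also have "\<dots> \<le> m * m" using that by (intro mult_le_mono1) auto
    finally show ?thesis .
  qed
  have "inj_on ?f ?P"
  proof (rule inj_onI)
    fix p q assume pq: "p \<in> ?P" "q \<in> ?P" "?f p = ?f q"
    then have "zip (T ! i) (T ! j) ! ?i p = zip (T ! i) (T ! j) ! ?i q" using lt l by simp
    moreover have "?i p < length (zip (T ! i) (T ! j))" "?i q < length (zip (T ! i) (T ! j))"
      using lt[OF pq(1)] lt[OF pq(2)] l by simp_all
    ultimately have "?i p = ?i q" using d nth_eq_iff_index_eq by blast
    moreover have "p = (?i p div m, ?i p mod m)" "q = (?i q div m, ?i q mod m)"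
      using pq(1,2) by (simp_all add: mem_Times_iff prod_eq_iff)
    ultimately show "p = q" by metis
  qed
  moreover have "?f ` ?P \<subseteq> ?P"
  proof
    fix y assume "y \<in> ?f ` ?P"
    then obtain p where p: "y = ?f p" "p \<in> ?P" by (rule imageE)
    have "T ! i ! ?i p \<in> set (T ! i)" "T ! j ! ?i p \<in> set (T ! j)" using lt[OF p(2)] l by simp_all
    then show "y \<in> ?P" using T(2)[OF nth_mem[OF ij(1)]] T(2)[OF nth_mem[OF ij(2)]] p(1) by simp
  qed
  ultimately show "bij_betw ?f ?P ?P" using endo_inj_surj[of ?P] by (simp add: bij_betw_def)
qed

text \<open>The rows are \<open>x\<close>, \<open>y\<close>, \<open>x + y\<close>, \<open>x + \<omega> y\<close>, \<open>x + \<omega>\<^sup>2 y\<close> over the field with four elements.\<close>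

lemma TD_5_4: "TD 5 4"
proof -
  have "TD_table 4 [[0,0,0,0,1,1,1,1,2,2,2,2,3,3,3,3],
    [0,1,2,3,0,1,2,3,0,1,2,3,0,1,2,3],
    [0,1,2,3,1,0,3,2,2,3,0,1,3,2,1,0],
    [0,2,3,1,1,3,2,0,2,0,1,3,3,1,0,2],
    [0,3,1,2,1,2,0,3,2,1,3,0,3,0,2,1]]"
    by code_simp
  from TD_from_table[OF this] show ?thesis by (simp add: numeral_eq_Suc)
qed

section \<open>Orders near \<open>8 * m\<close> from four holes of size \<open>2 * m\<close>\<close>

lemma full_4h_u:
  assumes td: "TD 5 m" and fs: "fullspec (replicate 4 (2 * m))" and u: "ends u" "u \<le> 3 * m"
  shows "full (8 * m + u)"
proof -
  have "fullspec (replicate 4 (2 * m) @ [u])"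
    using fs u by (intro fullspec_append_ends) (simp_all add: sum_list_replicate)
  with Fr_master[of "[]" m u] td u(2) have "full (sum_list (replicate 4 (2 * m) @ [u]))"
    by (intro full_CM[of "replicate 4 (2 * m) @ [u]"]) simp_all
  then show ?thesis by (simp add: sum_list_replicate)
qed

lemma full_4h_r_u:
  assumes td: "TD 6 m" and fs: "fullspec (replicate 4 (2 * m))" and r: "ends (2 * r)" "r \<le> m"
    and u: "ends u" "u \<le> 3 * m"
  shows "full (8 * m + 2 * r + u)"
proof -
  have "fullspec (replicate 4 (2 * m) @ [2 * r])"
    using fs r by (intro fullspec_append_ends) (simp_all add: sum_list_replicate)
  from fullspec_append_ends[OF this u(1)] have "fullspec (replicate 4 (2 * m) @ [2 * r, u])"
    using u(2) by (simp add: sum_list_replicate)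
  with Fr_master[of "[r]" m u] td r u(2) have "full (sum_list (replicate 4 (2 * m) @ [2 * r, u]))"
    by (intro full_CM[of "replicate 4 (2 * m) @ [2 * r, u]"]) simp_all
  then show ?thesis by (simp add: sum_list_replicate add.assoc)
qed

lemma full_4h_8_u:
  assumes td: "TD 6 m" and fs: "fullspec (replicate 4 (2 * m) @ [8])" "4 \<le> m"
    and u: "ends u" "u \<le> 3 * m"
  shows "full (8 * m + 8 + u)"
proof -
  from fullspec_append_ends[OF fs(1) u(1)] have "fullspec (replicate 4 (2 * m) @ [8, u])"
    using u(2) by (simp add: sum_list_replicate)
  with Fr_master[of "[4]" m u] td fs(2) u(2) have "full (sum_list (replicate 4 (2 * m) @ [8, u]))"
    by (intro full_CM[of "replicate 4 (2 * m) @ [8, u]"]) simp_all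
  then show ?thesis by (simp add: sum_list_replicate add.assoc)
qed

lemma full_4h_8_r_u:
  assumes td: "TD 7 m" and fs: "fullspec (replicate 4 (2 * m) @ [8])" "4 \<le> m" and r: "ends (2 * r)" "r \<le> m"
    and u: "ends u" "u \<le> 3 * m"
  shows "full (8 * m + 8 + 2 * r + u)"
proof -
  from fullspec_append_ends[OF fs(1) r(1)] have "fullspec (replicate 4 (2 * m) @ [8, 2 * r])"
    using r(2) by (simp add: sum_list_replicate)
  from fullspec_append_ends[OF this u(1)] have "fullspec (replicate 4 (2 * m) @ [8, 2 * r, u])"
    using u(2) by (simp add: sum_list_replicate)
  with Fr_master[of "[4, r]" m u] td fs(2) r u(2) have "full (sum_list (replicate 4 (2 * m) @ [8, 2 * r, u]))"
    by (intro full_CM[of "replicate 4 (2 * m) @ [8, 2 * r, u]"]) auto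
  then show ?thesis by (simp add: sum_list_replicate add.assoc)
qed

lemma ends_7_16: "7 \<le> u \<Longrightarrow> u \<le> 16 \<Longrightarrow> ends u"
  by (rule ends_small) simp

text \<open>Above 16 the remainder is spread over two holes: 17 to 26 is 10 plus 7 to 16, and 27 to
  30 is 14 plus 13 to 16. The bound \<open>r \<le> 7\<close> lets the hole of size
  \<open>2 * r\<close> fit whenever m is at least 7.\<close>

lemma split_ends:
  assumes "x \<in> {0, 1, 4, 5} \<or> 7 \<le> x \<and> x \<le> 30"
  obtains r u where "x = 2 * r + u" "r \<le> 7" "u \<le> 16" "ends (2 * r)" "ends u"
proof -
  consider "x \<in> {0, 1, 4, 5} \<or> 7 \<le> x \<and> x \<le> 16" | "17 \<le> x" "x \<le> 26" | "27 \<le> x" "x \<le> 30"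
    using assms by linarith
  then show thesis
  proof cases
    case 1
    then show ?thesis using ends_small[of x] ends_small[of 0] by (intro that[of 0 x]) auto
  next
    case 2
    then show ?thesis by (intro that[of 5 "x - 10"] ends_7_16) simp_all
  next
    case 3
    then show ?thesis by (intro that[of 7 "x - 14"] ends_7_16) simp_all
  qed
qed


lemma CM_top:
  assumes "TD 5 m" "CM (2 * m) (2 * m)" "CM u u" "u \<le> 3 * m"
  shows "CM (8 * m + u) (8 * m + u)"
proof -
  have "Fr (replicate 4 (2 * m) @ [u])" using Fr_master[of "[]" m u] assms by simp
  moreover have "spec (replicate 4 (2 * m) @ [u]) (8 * m + u)"
    by (rule spec_quad[OF assms(2,2,2,2) spec_single[OF assms(3)]]) simp
  ultimately show ?thesis
    using spec_CM[of "replicate 4 (2 * m) @ [u]"] by (force simp: sum_list_replicate)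
qed

text \<open>The remainder 2 above \<open>8 * m + 8\<close>. The hole of size 8 sits in the last
  group, where \<open>3 \<le> m\<close> makes room for it; for the remainder 6 in
  \<open>full_4h_8_6\<close> it is the hole of size 6 that sits there.\<close>

lemma full_4h_8_2:
  assumes "TD 6 m" "fullspec (replicate 4 (2 * m) @ [8])" "3 \<le> m" "CM (8 * m + 10) (8 * m + 10)"
  shows "full (8 * m + 10)"
proof (rule full_but_top[OF assms(2), of "replicate 4 (2 * m) @ [2, 8]" 2])
  show "Fr (replicate 4 (2 * m) @ [2, 8])" using Fr_master[of "[1]" m 8] assms by simp
qed (use assms(4) CM_2_0 in \<open>simp_all add: sum_list_replicate\<close>)

lemma full_4h_8_6:
  assumes "TD 6 m" "fullspec (replicate 4 (2 * m) @ [8])" "4 \<le> m" "CM (8 * m + 14) (8 * m + 14)"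
  shows "full (8 * m + 14)"
proof (rule full_but_top[OF assms(2), of "replicate 4 (2 * m) @ [8, 6]" 6])
  show "Fr (replicate 4 (2 * m) @ [8, 6])" using Fr_master[of "[4]" m 6] assms by simp
qed (use assms(4) CM_6_0 CM_6_4 in \<open>simp_all add: sum_list_replicate\<close>)

lemma full_4h_7:
  assumes "TD 5 m" "fullspec (replicate 4 (2 * m) @ [7])" "3 \<le> m"
  shows "full (8 * m + 7)"
  using full_CM[of "replicate 4 (2 * m) @ [7]" "replicate 4 (2 * m) @ [7]"] Fr_master[of "[]" m 7] assms
  by (simp add: sum_list_replicate)

text \<open>The remainder 3 above \<open>8 * m + 8\<close> cannot be a hole by itself, so 8 + 3 is
  replaced by 4 + 7.\<close>

lemma full_4h_4_7:
  assumes "TD 6 m" "fullspec hs" "mset hs = mset (replicate 4 (2 * m) @ [4, 7])" "3 \<le> m"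
  shows "full (8 * m + 11)"
proof -
  have "Fr (replicate 4 (2 * m) @ [4, 7])" using Fr_master[of "[2]" m 7] assms by simp
  then have "full (sum_list hs)" by (rule full_CM[OF _ assms(3,2)])
  moreover have "sum_list hs = 8 * m + 11"
    using arg_cong[OF assms(3), of sum_mset] by (simp only: sum_mset_sum_list) (simp add: sum_list_replicate)
  ultimately show ?thesis by simp
qed

section \<open>The orders from 32 to 142\<close>

lemma TD_small:
  "m \<in> {5, 7, 11, 13, 17, 19, 23, 25} \<Longrightarrow> TD 5 m \<and> TD 6 m"
proof -
  assume "m \<in> {5, 7, 11, 13, 17, 19, 23, 25}"
  then have "coprime m 6" "m > 0" by (auto simp: coprime_iff_gcd_eq_1 gcd_nat.simps[of _ "numeral _"])
  then show ?thesis using TD_coprime_6 by blast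
qed

text \<open>Four holes of size 8 leave the remainder n - 32, at most 12 = 3 * 4, and only 2, 3 and 6
  are not admissible. For 34 and 38 just \<open>k = n\<close> needs another frame; 35 uses seven
  holes of size 4 and one of size 7.\<close>

lemma full_32_44: "32 \<le> n \<Longrightarrow> n \<le> 44 \<Longrightarrow> full n"
proof -
  have fs: "fullspec (replicate 4 8)" by (rule fullspec_replicate[OF full_8]) simp
  have "full 34"
  proof (rule full_but_top[OF fs, of "replicate 4 8 @ [2]" 2])
    show "Fr (replicate 4 8 @ [2])" using Fr_master[of "[]" 4 2] TD_5_4 by simp
    show "CM 34 34" using CM_sols[OF Fr_1_27_7 CM_7_7] by simp
  qed (use CM_2_0 in \<open>simp_all add: sum_list_replicate\<close>)
  moreover have "full 38"
  proof (rule full_but_top[OF fs, of "replicate 4 8 @ [6]" 6])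
    show "Fr (replicate 4 8 @ [6])" using Fr_master[of "[]" 4 6] TD_5_4 by simp
    show "CM 38 38" using CM_sols[OF Fr_1_31_7 CM_7_7] by simp
  qed (use CM_6_0 CM_6_4 in \<open>simp_all add: sum_list_replicate\<close>)
  moreover have "full 35"
    unfolding full_def
  proof (intro allI impI)
    fix k :: nat assume k: "k \<le> 35" "even (35 - k)"
    then obtain j c where "k = 4 * j + c" "c \<in> {1, 3, 5, 7}" "j \<le> 7"
    proof -
      \<comment> \<open>The holes of size 4 hold at most 28 couples, so 33 and 35 need 5 and 7 in
        the last hole.\<close>
      consider "k \<le> 31" | "k = 33" | "k = 35" using k by atomize_elim presburger
      then show thesis
      proof cases
        case 1
        have "k = 4 * (k div 4) + k mod 4" "k div 4 \<le> 7" using 1 by simp_all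
        moreover have "k mod 4 \<in> {1, 3}" using k unfolding insert_iff empty_iff by presburger
        ultimately show ?thesis using that by blast
      qed (use that[of 7 5] that[of 7 7] in simp_all)
    qed
    then show "CM 35 k" using CM_fours[OF Fr_4_7_7 CM_7] by simp
  qed
  moreover assume n: "32 \<le> n" "n \<le> 44"
  moreover have "full n" if "n \<noteq> 34" "n \<noteq> 35" "n \<noteq> 38"
  proof -
    have "n - 32 \<in> {0, 1, 4, 5} \<or> 7 \<le> n - 32 \<and> n - 32 \<le> 16"
      using n that unfolding insert_iff empty_iff by presburger
    from full_4h_u[OF TD_5_4 _ ends_small[OF this]] fs n show ?thesis by simp
  qed
  ultimately show ?thesis by blast
qed

lemma spec_10:
  assumes "a + b \<le> 4" "spec hs y" "x = 10 * a + 8 * b + y"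
  shows "spec (replicate 4 10 @ hs) x"
proof -
  let ?k = "\<lambda>i. if i < a then 10 else if i < a + b then 8 else 0"
  have k: "CM 10 (?k i)" for i :: nat using CM_10_0 CM_10_8 CM_10_10 by simp
  have "a \<in> {0, 1, 2, 3, 4}" "b \<in> {0, 1, 2, 3, 4}" using assms(1) unfolding insert_iff empty_iff by presburger+
  then have "x = ?k 0 + ?k 1 + ?k 2 + ?k 3 + y" using assms(1,3) by auto
  then show ?thesis using spec_quad[OF k[of 0] k[of 1] k[of 2] k[of 3] assms(2)] by blast
qed

text \<open>Each hole of size 10 offers 0, 8 and 10, the hole of size 5 offers 1 and 5. Modulo 10,
  residue 3 is 8 + 5 and residue 7 is 8 + 8 + 1; both borrow a ten, hence the separate frame for
  \<open>k \<le> 7\<close>.\<close>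

lemma full_45: "full 45"
  unfolding full_def
proof (intro allI impI)
  fix k :: nat assume k: "k \<le> 45" "even (45 - k)"
  show "CM 45 k"
  proof (cases "k \<le> 7")
    case True
    then have "k \<in> {1, 3, 5, 7}" using k unfolding insert_iff empty_iff by presburger
    then show ?thesis using CM_pairs[OF Fr_2_19_7 CM_7] by simp
  next
    case False
    define q where "q = k div 10"
    have q: "k = 10 * q + k mod 10" by (simp add: q_def)
    note e = spec_single[OF CM_5_1] spec_single[OF CM_5_5]
    have "k mod 10 \<in> {1, 3, 5, 7, 9}" using k unfolding insert_iff empty_iff by presburger
    then consider "k = 10 * q + 1" | "k = 10 * q + 3" | "k = 10 * q + 5" | "k = 10 * q + 7" | "k = 10 * q + 9"
      using q by auto
    then have "spec (replicate 4 10 @ [5]) k"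
    proof cases
      case 1
      with k show ?thesis by (intro spec_10[of q 0, OF _ e(1)]) linarith+
    next
      case 2
      with k False show ?thesis by (intro spec_10[of "q - 1" 1, OF _ e(2)]) linarith+
    next
      case 3
      with k show ?thesis by (intro spec_10[of q 0, OF _ e(2)]) linarith+
    next
      case 4
      with k False show ?thesis by (intro spec_10[of "q - 1" 2, OF _ e(1)]) linarith+
    next
      case 5
      with k show ?thesis by (intro spec_10[of q 1, OF _ e(1)]) linarith+
    qed
    moreover have "Fr (replicate 4 10 @ [5])" using Fr_master[of "[]" 5 5] TD_small by simp
    ultimately show ?thesis using spec_CM[of "replicate 4 10 @ [5]"] by (force simp: sum_list_replicate)
  qed
qed

text \<open>As for 45, with 0 or 4 couples in the hole of size 6: residue 2 is 8 + 4 and residue 6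
  is 8 + 8, each borrowing a ten. For \<open>k = 46\<close> this would take five holes of size
  10.\<close>

lemma full_46: "full 46"
  unfolding full_def
proof (intro allI impI)
  fix k :: nat assume k: "k \<le> 46" "even (46 - k)"
  consider "k \<le> 8" | "k = 46" | "8 < k" "k \<noteq> 46" by linarith
  then show "CM 46 k"
  proof cases
    case 1
    then have "k \<in> {0, 2, 4, 6, 8}" using k unfolding insert_iff empty_iff by presburger
    then show ?thesis using CM_pairs[OF Fr_2_19_8 CM_8] by simp
  next
    case 2
    then show ?thesis using CM_sols[OF Fr_1_37_9 CM_9_9] by simp
  next
    case 3
    define q where "q = k div 10"
    have q: "k = 10 * q + k mod 10" by (simp add: q_def)
    note e = spec_single[OF CM_6_0] spec_single[OF CM_6_4]
    have "k mod 10 \<in> {0, 2, 4, 6, 8}" using k unfolding insert_iff empty_iff by presburger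
    then consider "k = 10 * q" | "k = 10 * q + 2" | "k = 10 * q + 4" | "k = 10 * q + 6" | "k = 10 * q + 8"
      using q by auto
    then have "spec (replicate 4 10 @ [6]) k"
    proof cases
      case 1
      with k show ?thesis by (intro spec_10[of q 0, OF _ e(1)]) linarith+
    next
      case 2
      with k 3 show ?thesis by (intro spec_10[of "q - 1" 1, OF _ e(2)]) linarith+
    next
      case 3
      with k show ?thesis by (intro spec_10[of q 0, OF _ e(2)]) linarith+
    next
      case 4
      with k \<open>8 < k\<close> \<open>k \<noteq> 46\<close> show ?thesis by (intro spec_10[of "q - 1" 2, OF _ e(1)]) linarith+
    next
      case 5
      with k show ?thesis by (intro spec_10[of q 1, OF _ e(1)]) linarith+
    qed
    moreover have "Fr (replicate 4 10 @ [6])" using Fr_master[of "[]" 5 6] TD_small by simp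
    ultimately show ?thesis using spec_CM[of "replicate 4 10 @ [6]"] by (force simp: sum_list_replicate)
  qed
qed


text \<open>The base is 48 = 4 * 10 + 8 with remainders up to 15. The orders 50, 51 and 54 are the
  remainders 2, 3 and 6; for 47 the hole of size 8 shrinks to 7.\<close>

lemma full_47_63: "47 \<le> n \<Longrightarrow> n \<le> 63 \<Longrightarrow> full n"
proof -
  have td: "TD 5 5" "TD 6 5" using TD_small by simp_all
  have fs: "fullspec (replicate 4 (2 * 5) @ [8])" using fullspec_10_8 by simp
  have f7: "fullspec (replicate 4 (2 * 5) @ [7])" using fullspec_10_7 by simp
  have "full 47" using full_4h_7[OF td(1) f7] by simp
  moreover have "full 50" using full_4h_8_2[OF td(2) fs] CM_top[OF td(1), of 10] CM_10_10 by simp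
  moreover have "full 51"
  proof -
    have "fullspec ((replicate 4 (2 * 5) @ [7]) @ [4])"
      by (rule fullspec_append_ends[OF f7]) (simp_all add: ends_small sum_list_replicate)
    from full_4h_4_7[OF td(2) this] show ?thesis by simp
  qed
  moreover have "full 54"
  proof -
    have "Fr (replicate 4 10 @ [10, 4])" using Fr_master[of "[5]" 5 4] td by simp
    moreover have "spec (replicate 4 10 @ [10, 4]) 54"
      by (rule spec_10[of 4 0, OF _ spec_Cons[OF CM_10_10 spec_single[OF CM_4_4]]]) simp_all
    ultimately have "CM 54 54" using spec_CM[of "replicate 4 10 @ [10, 4]"] by (force simp: sum_list_replicate)
    then show ?thesis using full_4h_8_6[OF td(2) fs] by simp
  qed
  moreover assume n: "47 \<le> n" "n \<le> 63"
  moreover have "full n" if "n \<notin> {47, 50, 51, 54}"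
  proof -
    have "ends (n - 48)" using n that by (intro ends_small) (unfold insert_iff empty_iff, presburger)
    from full_4h_8_u[OF td(2) fs _ this] n that show ?thesis by simp
  qed
  ultimately show ?thesis by blast
qed

lemma full_4h_8:
  assumes m: "m \<in> {7, 11, 13}" and fs: "fullspec (replicate 4 (2 * m) @ [8])"
    and x: "x \<in> {0, 1, 4, 5} \<or> 7 \<le> x \<and> x \<le> 30"
  shows "full (8 * m + 8 + x)"
proof -
  obtain r u where ru: "x = 2 * r + u" "r \<le> 7" "u \<le> 16" "ends (2 * r)" "ends u"
    using split_ends[OF x] .
  have "full (8 * m + 8 + 2 * r + u)"
    using m ru by (intro full_4h_8_r_u[OF TD_7[OF m] fs]) auto
  then show ?thesis by (simp add: ru(1) add.assoc)
qed

text \<open>The bases 64, 96 and 112 are \<open>8 * m + 8\<close> for m = 7, 11, 13, with remainders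
  up to 30. The remainders 2, 3 and 6 give 66, 67, 70, 98, 99 and 102; 95 would be the remainder 31
  above 64 and is written as 88 + 7.\<close>

lemma full_64_142: "64 \<le> n \<Longrightarrow> n \<le> 142 \<Longrightarrow> full n"
proof -
  have td: "TD 5 7" "TD 6 7" "TD 5 11" "TD 6 11" using TD_small by simp_all
  have f7: "fullspec (replicate 4 (2 * 7) @ [8])" using fullspec_14_8 by simp
  have f11: "fullspec (replicate 4 (2 * 11) @ [8])" using fullspec_22[OF full_8] by simp
  have g11: "fullspec (replicate 4 (2 * 11) @ [7])" using fullspec_22[OF full_7] by simp
  have f13: "fullspec (replicate 4 (2 * 13) @ [8])" using fullspec_26[OF full_8] by simp
  have "full 66" using full_4h_8_2[OF td(2) f7] CM_top[OF td(1), of 10] CM_10_10 CM_14_14 by simp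
  moreover have "full 67" using full_4h_4_7[OF td(2) fullspec_14_4_7] by simp
  moreover have "full 70" using full_4h_8_6[OF td(2) f7] CM_top[OF td(1), of 14] CM_14_14 by simp
  moreover have "full 95" using full_4h_7[OF td(3) g11] by simp
  moreover have "full 98" using full_4h_8_2[OF td(4) f11] CM_top[OF td(3), of 10] CM_10_10 CM_22_22 by simp
  moreover have "full 99"
  proof -
    have "fullspec ((replicate 4 (2 * 11) @ [7]) @ [4])"
      by (rule fullspec_append_ends[OF g11]) (simp_all add: ends_small sum_list_replicate)
    from full_4h_4_7[OF td(4) this] show ?thesis by simp
  qed
  moreover have "full 102" using full_4h_8_6[OF td(4) f11] CM_top[OF td(3), of 14] CM_14_14 CM_22_22 by simp
  moreover have "full n" if "64 \<le> n" "n \<le> 94" "n \<notin> {66, 67, 70}"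
  proof -
    have "n - 64 \<in> {0, 1, 4, 5} \<or> 7 \<le> n - 64 \<and> n - 64 \<le> 30"
      using that unfolding insert_iff empty_iff by presburger
    from full_4h_8[OF _ f7 this] that(1) show ?thesis by simp
  qed
  moreover have "full n" if "96 \<le> n" "n \<le> 126" "n \<notin> {98, 99, 102}"
  proof -
    have "n - 96 \<in> {0, 1, 4, 5} \<or> 7 \<le> n - 96 \<and> n - 96 \<le> 30"
      using that unfolding insert_iff empty_iff by presburger
    from full_4h_8[OF _ f11 this] that(1) show ?thesis by simp
  qed
  moreover have "full n" if "119 \<le> n" "n \<le> 142"
  proof -
    have "n - 112 \<in> {0, 1, 4, 5} \<or> 7 \<le> n - 112 \<and> n - 112 \<le> 30" using that by linarith
    from full_4h_8[OF _ f13 this] that(1) show ?thesis by simp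
  qed
  moreover assume "64 \<le> n" "n \<le> 142"
  then have "n = 66 \<or> n = 67 \<or> n = 70 \<or> n = 95 \<or> n = 98 \<or> n = 99 \<or> n = 102 \<or>
     n \<le> 94 \<and> n \<notin> {66, 67, 70} \<or> 96 \<le> n \<and> n \<le> 126 \<and> n \<notin> {98, 99, 102} \<or> 119 \<le> n" by auto
  ultimately show ?thesis using \<open>64 \<le> n\<close> \<open>n \<le> 142\<close> by metis
qed

section \<open>The induction over n\<close>

lemma full_4h:
  assumes td: "TD 5 m" "TD 6 m" and m: "full (2 * m)" "16 \<le> m"
    and x: "7 \<le> x \<and> x \<le> 30 \<or> 32 \<le> x \<and> x \<le> 3 * m \<and> full x"
  shows "full (8 * m + x)"
proof -
  have fs: "fullspec (replicate 4 (2 * m))" using fullspec_replicate[OF m(1)] by simp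
  from x show ?thesis
  proof (elim disjE)
    assume "7 \<le> x \<and> x \<le> 30"
    then obtain r u where ru: "x = 2 * r + u" "r \<le> 7" "u \<le> 16" "ends (2 * r)" "ends u"
      using split_ends[of x] by blast
    have "full (8 * m + 2 * r + u)"
      using m(2) ru by (intro full_4h_r_u[OF td(2) fs]) auto
    then show ?thesis by (simp add: ru(1) add.assoc)
  qed (use full_4h_u[OF td(1) fs] full_ends in blast)
qed

lemma full_ge_32: "32 \<le> n \<Longrightarrow> full n"
proof (induction n rule: less_induct)
  case (less n)
  have step: "full n" if "m \<in> {17, 19, 23, 25}"
    "8 * m \<le> n" "7 \<le> n - 8 * m \<and> n - 8 * m \<le> 30 \<or> 32 \<le> n - 8 * m \<and> n - 8 * m \<le> 3 * m" for m
  proof -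
    have "TD 5 m" "TD 6 m" using that(1) TD_small[of m] by auto
    moreover have "16 \<le> m" using that(1) by auto
    moreover from this have "full (2 * m)" using less.prems that by (intro less.IH) linarith+
    moreover have "full (n - 8 * m)" if "32 \<le> n - 8 * m" using that \<open>16 \<le> m\<close> by (intro less.IH) linarith+
    ultimately have "full (8 * m + (n - 8 * m))" using that by (intro full_4h) blast+
    then show ?thesis using that(2) by simp
  qed
  \<comment> \<open>From 143 to 230 each range lies above 8 * 17 = 136, 8 * 19 = 152, 8 * 23 = 184
    or 8 * 25 = 200, at a distance between 7 and 30 or between 32 and 3m.\<close>
  consider "n \<le> 44" | "n = 45" | "n = 46" | "47 \<le> n" "n \<le> 63" | "64 \<le> n" "n \<le> 142" | "143 \<le> n" "n \<le> 166"
    | "167 \<le> n" "n \<le> 182" | "183 \<le> n" "n \<le> 187" | "188 \<le> n" "n \<le> 209" | "210 \<le> n" "n \<le> 215"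
    | "216 \<le> n" "n \<le> 230" | "231 \<le> n" by linarith
  then show ?case
  proof cases
    case 12
    define q where "q = (n - 32) div 8"
    have q: "8 * q \<le> n - 32" "n - 32 < 8 * q + 8" by (simp_all add: q_def)
    obtain m where m: "coprime m 6" "m \<le> q" "q \<le> m + 3"
    proof -
      \<comment> \<open>The residues 1 and 5 modulo 6 leave gaps of at most 4, so one of the four
        numbers q - 3, ..., q is coprime to 6.\<close>
      have "\<exists>m. m \<le> q \<and> q \<le> m + 3 \<and> odd m \<and> m mod 3 \<noteq> 0" using q 12 by presburger
      then obtain m where m: "m \<le> q" "q \<le> m + 3" "odd m" "m mod 3 \<noteq> 0" by blast
      have "coprime m 2" using m(3) by simp
      moreover have "coprime m 3"
      proof -
        have "m mod 3 = 1 \<or> m mod 3 = 2" using m(4) by linarith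
        then show ?thesis
          using gcd_red_nat[of m 3] gcd_nat.simps[of 3 2] by (auto simp: coprime_iff_gcd_eq_1)
      qed
      ultimately have "coprime m (2 * 3)" by (simp only: coprime_mult_right_iff)
      then show thesis using that m by simp
    qed
    \<comment> \<open>The bounds \<open>m \<le> q\<close> and \<open>q \<le> m + 3\<close> put
      \<open>n - 8 * m\<close> between 32 and 63, and m \<ge> 21 gives 63 \<le> 3m.\<close>
    have "21 \<le> m" using m q 12 by linarith
    then have "TD 5 m" "TD 6 m" using TD_coprime_6 m by simp_all
    moreover have "full (2 * m)" "full (n - 8 * m)" "n - 8 * m \<le> 63" "32 \<le> n - 8 * m"
      using m q \<open>21 \<le> m\<close> 12 by (auto intro!: less.IH)
    ultimately have "full (8 * m + (n - 8 * m))" using \<open>21 \<le> m\<close> by (intro full_4h) auto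
    then show ?thesis using \<open>32 \<le> n - 8 * m\<close> by simp
  next
    case 1
    then show ?thesis using full_32_44 less.prems by simp
  next
    case 2
    then show ?thesis using full_45 by simp
  next
    case 3
    then show ?thesis using full_46 by simp
  next
    case 4
    then show ?thesis using full_47_63 by simp
  next
    case 5
    then show ?thesis using full_64_142 by simp
  next
    case 6
    then show ?thesis by (intro step[of 17]) (simp, linarith+)
  next
    case 7
    then show ?thesis by (intro step[of 19]) (simp, linarith+)
  next
    case 8
    then show ?thesis by (intro step[of 17]) (simp, linarith+)
  next
    case 9
    then show ?thesis by (intro step[of 19]) (simp, linarith+)
  next
    case 10
    then show ?thesis by (intro step[of 25]) (simp, linarith+)
  next
    case 11
    then show ?thesis by (intro step[of 23]) (simp, linarith+)
  qed
qed

theorem theorem4: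
  fixes n k :: nat
  assumes "n \<ge> 32" and "k \<le> n" and "even (n - k)"
  shows "\<exists>Sp G. is_CMDRR n k Sp G"
  using CM_imp_CMDRR full_ge_32[OF assms(1)] assms(2,3) unfolding full_def by blast

end
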